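(* Let $X=\left\{\sum_{n=1}^{\infty}\frac{\alpha_n}{4^n} : \alpha_n\in\{0,2,3,5\}\text{ for all } n\ge 1\right\}\subset\mathbb{R}$, which is the set of subsums of the Guthrie-Nymann series. Let $X_I$ be the interior of $X$ and $X_C$ the boundary of $X$ in $\mathbb{R}$. Then $X$ is the disjoint union $X=X_I\sqcup X_C$, where $X_I$ is an infinite union of open intervals and has Lebesgue measure equal to $1$, and $X_C$ is a Cantor set with zero Lebesgue measure and fractional Hausdorff dimension $\dim_H X_C=\log_4 3$.
   Context: The Guthrie-Nymann series is $\frac34+\frac24+\frac3{4^2}+\frac2{4^2}+\dots+\frac3{4^n}+\frac2{4^n}+\dots$. The set of subsums of a convergent positive series $\sum a_n$ is $E(a_n)=\left\{\sum_{n=1}^\infty \varepsilon_n a_n : (\varepsilon_n)\in\{0,1\}^{\mathbb{N}}\right\}$. A Cantor set is a set homeomorphic to the Cantor ternary set. "Fractional" means non-integer. *)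

theory Defs
  imports "HOL-Analysis.Analysis"
begin

text \<open>Series are indexed from 1; the term with index 0 is never used.\<close>

definition subsums :: "(nat \<Rightarrow> real) \<Rightarrow> real set" where
  "subsums a = {\<Sum>n. \<epsilon> (Suc n) * a (Suc n) | \<epsilon>. \<forall>n\<ge>1. \<epsilon> n \<in> {0, 1}}"

text \<open>The series is 3/4 + 2/4 + 3/16 + 2/16 + \dots: the terms with
  indices \<open>2k - 1\<close> and \<open>2k\<close> are \<open>3/4^k\<close> and \<open>2/4^k\<close>.\<close>

definition guthrie_nymann :: "nat \<Rightarrow> real" where
  "guthrie_nymann n = (if odd n then 3 else 2) / 4 ^ ((n + 1) div 2)"

definition cantor_ternary_set :: "real set" where
  "cantor_ternary_set = {\<Sum>n. t (Suc n) / 3 ^ Suc n | t. \<forall>n\<ge>1. t n \<in> {0, 2}}"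

definition is_cantor_set :: "'a::topological_space set \<Rightarrow> bool" where
  "is_cantor_set S \<longleftrightarrow> S homeomorphic cantor_ternary_set"

text \<open>The contribution \<open>(diam U)^s\<close> of a bounded covering set, with the usual
  conventions that the empty set contributes 0 for every \<open>s\<close> and that
  \<open>0^0 = 1\<close> (whereas \<open>0 powr 0 = 0\<close>).\<close>

definition diam_pow :: "real \<Rightarrow> 'a::metric_space set \<Rightarrow> ennreal" where
  "diam_pow s U =
    (if U = {} then 0 else if s = 0 then 1 else ennreal (diameter U powr s))"

text \<open>Boundedness of the covering sets is required explicitly because
  \<^const>\<open>diameter\<close> is unspecified on unbounded sets.\<close>

definition hausdorff_premeasure :: "real \<Rightarrow> real \<Rightarrow> 'a::metric_space set \<Rightarrow> ennreal" where
  "hausdorff_premeasure s \<delta> A =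
    Inf {\<Sum>i. diam_pow s (U i) | U :: nat \<Rightarrow> 'a set.
      A \<subseteq> (\<Union>i. U i) \<and> (\<forall>i. bounded (U i) \<and> diameter (U i) \<le> \<delta>)}"

definition hausdorff_measure :: "real \<Rightarrow> 'a::metric_space set \<Rightarrow> ennreal" where
  "hausdorff_measure s A = (SUP \<delta>\<in>{0<..}. hausdorff_premeasure s \<delta> A)"

definition hausdorff_dim :: "'a::metric_space set \<Rightarrow> ereal" where
  "hausdorff_dim A = Inf {ereal s | s. 0 \<le> s \<and> hausdorff_measure s A = 0}"

end

theory Submission
  imports Defs
begin

text \<open>
  The set \<open>X\<close> consists of the numbers with base 4 expansions in the digits \<open>0, 2, 3, 5\<close>, and it
  is the attractor of the contractions \<open>x \<mapsto> (x + d) / 4\<close> for these \<open>d\<close>. The digits form a complete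
  system of residues modulo 4, so the integer translates of \<open>X\<close> cover the line
  (\<open>tile_covers\<close>): \<open>X\<close> is a tile. As \<open>X\<close> lies in \<open>{0..5/3}\<close>, it meets only its translates by
  \<open>1\<close> and \<open>-1\<close>. Following the carries in \<open>x + 1 = y\<close> with \<open>x, y \<in> X\<close> shows that the overlap
  \<open>X \<inter> (X - 1)\<close> is the set \<open>E\<close> of all base 4 expansions in the digits \<open>0, 1, 2\<close>
  (\<open>edge_eq_overlap\<close>). It is null, being made of three copies of itself scaled by \<open>1/4\<close>, and the
  boundary of \<open>X\<close> is the disjoint union of \<open>E\<close> and \<open>E + 1\<close> (\<open>frontier_tile\<close>). Everything else
  follows from this description.

  Since the translates cover the line with null overlaps, \<open>X\<close> has measure 1, and so has its
  interior. The interior is dense in \<open>X\<close>, so its boundary is that of \<open>X\<close>, which is infinite,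
  and hence it has infinitely many components.

  The set \<open>E\<close> is homeomorphic to the space of sequences over \<open>{0,1,2}\<close>, because its three
  pieces are disjoint. The ternary Cantor set is homeomorphic to the same space, since its
  binary addresses can be cut into the words of a complete prefix code with three words. Both
  the boundary and the Cantor set are two disjoint copies of such a set, which gives the
  homeomorphism.

  For the dimension, \<open>2 * 3 ^ n\<close> intervals of length \<open>4 ^ -n\<close> cover the boundary, which gives the
  upper bound \<open>log 4 3\<close>. For the lower bound, reading base 4 digits in base 3 maps \<open>E\<close> onto
  the unit interval and is Hoelder continuous with exponent \<open>log 4 3\<close>.
\<close>

section \<open>Attractors of affine contractions and their coding maps\<close>

lemma compact_digit_sequences:
  fixes I :: "nat set"
  assumes "finite I"
  shows "compact {\<omega> :: nat \<Rightarrow> nat. \<forall>n. \<omega> n \<in> I}"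
proof -
  have "compactin (product_topology (\<lambda>_. euclidean) UNIV) (PiE UNIV (\<lambda>_::nat. I))"
    using assms by (subst compactin_PiE) (auto intro: finite_imp_compact)
  then have "compact (PiE UNIV (\<lambda>_::nat. I))"
    by (simp add: euclidean_product_topology)
  moreover have "PiE UNIV (\<lambda>_::nat. I) = {\<omega>. \<forall>n. \<omega> n \<in> I}"
    by auto
  ultimately show ?thesis by simp
qed

text \<open>A finite family of orientation-preserving affine contractions
  \<open>x \<mapsto> b i + r i * x\<close> of the real line. The letters are natural numbers, so that the
  product topology on \<^typ>\<open>nat \<Rightarrow> nat\<close> is the usual topology on sequences over a discrete
  alphabet.\<close>
locale affine_ifs =
  fixes I :: "nat set" and r b :: "nat \<Rightarrow> real"
  assumes finite_I: "finite I"
    and ratio_pos: "i \<in> I \<Longrightarrow> 0 < r i"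
    and ratio_less_1: "i \<in> I \<Longrightarrow> r i < 1"
begin

definition codes :: "(nat \<Rightarrow> nat) set" where
  "codes = {\<omega>. \<forall>n. \<omega> n \<in> I}"

text \<open>Composing the maps named by the first \<open>N\<close> letters of \<open>\<omega>\<close> and applying the result to \<open>y\<close>
  gives the sum of the first \<open>N\<close> of these terms plus \<open>(\<Prod>k<N. r (\<omega> k)) * y\<close>. The series of
  all terms is therefore the point coded by \<open>\<omega>\<close>.\<close>
definition code_term :: "nat \<Rightarrow> (nat \<Rightarrow> nat) \<Rightarrow> real" where
  "code_term n \<omega> = b (\<omega> n) * (\<Prod>k<n. r (\<omega> k))"

definition code_sum :: "(nat \<Rightarrow> nat) \<Rightarrow> real" where
  "code_sum \<omega> = (\<Sum>n. code_term n \<omega>)"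

text \<open>The set of all coded points, which is the attractor of the family in Hutchinson's sense;
  it is empty when there are no letters.\<close>
definition attractor :: "real set" where
  "attractor = code_sum ` codes"

lemma compact_codes: "compact codes"
  unfolding codes_def by (rule compact_digit_sequences[OF finite_I])

lemma codes_shift: "\<omega> \<in> codes \<Longrightarrow> (\<lambda>n. \<omega> (Suc n)) \<in> codes"
  by (simp add: codes_def)

lemma uniform_ratio:
  obtains \<rho> where "0 \<le> \<rho>" "\<rho> < 1" "\<And>\<omega> n. \<omega> \<in> codes \<Longrightarrow> 0 < (\<Prod>k<n. r (\<omega> k))"
    "\<And>\<omega> n. \<omega> \<in> codes \<Longrightarrow> (\<Prod>k<n. r (\<omega> k)) \<le> \<rho> ^ n"
proof -
  define \<rho> where "\<rho> = Max (insert 0 (r ` I))"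
  have fin: "finite (insert 0 (r ` I))" using finite_I by simp
  have 1: "0 \<le> \<rho>" unfolding \<rho>_def using fin by (intro Max_ge) auto
  have 2: "\<rho> < 1" unfolding \<rho>_def using fin ratio_less_1 by (subst Max_less_iff) auto
  have 3: "r i \<le> \<rho>" if "i \<in> I" for i unfolding \<rho>_def using fin that by (intro Max_ge) auto
  have 4: "0 < (\<Prod>k<n. r (\<omega> k))" if "\<omega> \<in> codes" for \<omega> n
    using that ratio_pos by (intro prod_pos) (auto simp: codes_def)
  have "(\<Prod>k<n. r (\<omega> k)) \<le> (\<Prod>k<n. \<rho>)" if "\<omega> \<in> codes" for \<omega> n
    using that ratio_pos 3 by (intro prod_mono) (auto simp: codes_def less_imp_le)
  then show ?thesis using 1 2 4 by (intro that[of \<rho>]) auto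
qed

lemma code_term_bound:
  obtains \<rho> M where "0 \<le> \<rho>" "\<rho> < 1" "\<And>\<omega> n. \<omega> \<in> codes \<Longrightarrow> norm (code_term n \<omega>) \<le> M * \<rho> ^ n"
proof -
  obtain \<rho> where \<rho>: "0 \<le> \<rho>" "\<rho> < 1" "\<And>\<omega> n. \<omega> \<in> codes \<Longrightarrow> 0 < (\<Prod>k<n. r (\<omega> k))"
    "\<And>\<omega> n. \<omega> \<in> codes \<Longrightarrow> (\<Prod>k<n. r (\<omega> k)) \<le> \<rho> ^ n"
    using uniform_ratio by blast
  define M where "M = Max (insert 0 ((\<lambda>i. \<bar>b i\<bar>) ` I))"
  have fin: "finite (insert 0 ((\<lambda>i. \<bar>b i\<bar>) ` I))" using finite_I by simp
  have M0: "0 \<le> M" unfolding M_def using fin by (intro Max_ge) auto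
  have M: "\<bar>b i\<bar> \<le> M" if "i \<in> I" for i unfolding M_def using fin that by (intro Max_ge) auto
  have "norm (code_term n \<omega>) \<le> M * \<rho> ^ n" if "\<omega> \<in> codes" for \<omega> n
  proof -
    have "norm (code_term n \<omega>) = \<bar>b (\<omega> n)\<bar> * (\<Prod>k<n. r (\<omega> k))"
      using \<rho>(3)[OF that, of n] by (simp add: code_term_def abs_mult)
    also have "\<dots> \<le> M * \<rho> ^ n"
      using that \<rho>(3,4)[OF that, of n] M[of "\<omega> n"] M0 by (intro mult_mono) (auto simp: codes_def)
    finally show ?thesis .
  qed
  then show ?thesis using \<rho>(1,2) that by blast
qed

lemma summable_code_term:
  assumes "\<omega> \<in> codes"
  shows "summable (\<lambda>n. code_term n \<omega>)"
proof -
  obtain \<rho> M where \<rho>: "0 \<le> \<rho>" "\<rho> < 1" and bd: "\<And>\<omega> n. \<omega> \<in> codes \<Longrightarrow> norm (code_term n \<omega>) \<le> M * \<rho> ^ n"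
    using code_term_bound by blast
  have "summable (\<lambda>n. M * \<rho> ^ n)"
    by (rule summable_mult[OF summable_geometric]) (use \<rho> in simp)
  then show ?thesis
    by (rule summable_comparison_test') (rule bd[OF assms])
qed

lemma continuous_on_code_sum: "continuous_on codes code_sum"
proof -
  obtain \<rho> M where bd: "0 \<le> \<rho>" "\<rho> < 1" "\<And>\<omega> n. \<omega> \<in> codes \<Longrightarrow> norm (code_term n \<omega>) \<le> M * \<rho> ^ n"
    using code_term_bound by blast
  have digit: "continuous_on codes (\<lambda>\<omega>. h (\<omega> n))" for h :: "nat \<Rightarrow> real" and n
  proof (rule continuous_on_compose2[of UNIV h])
    show "continuous_on UNIV h" by simp
    show "continuous_on codes (\<lambda>\<omega>. \<omega> n)"
      by (rule continuous_on_subset[OF continuous_on_product_coordinates]) auto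
  qed auto
  have "uniform_limit codes (\<lambda>n \<omega>. \<Sum>i<n. code_term i \<omega>) (\<lambda>\<omega>. \<Sum>i. code_term i \<omega>) sequentially"
    using bd summable_mult[OF summable_geometric, of \<rho> M]
    by (intro Weierstrass_m_test[where M = "\<lambda>n. M * \<rho> ^ n"]) simp_all
  then have "continuous_on codes (\<lambda>\<omega>. \<Sum>i. code_term i \<omega>)"
    by (rule uniform_limit_theorem[rotated])
       (auto simp: code_term_def intro!: always_eventually continuous_intros digit)
  then show ?thesis by (simp add: code_sum_def[abs_def])
qed

lemma compact_attractor: "compact attractor"
  unfolding attractor_def by (intro compact_continuous_image continuous_on_code_sum compact_codes)

lemma code_sum_unfold:
  assumes "\<omega> \<in> codes"
  shows "code_sum \<omega> = b (\<omega> 0) + r (\<omega> 0) * code_sum (\<lambda>n. \<omega> (Suc n))"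
proof -
  have sh: "(\<lambda>n. \<omega> (Suc n)) \<in> codes" using assms by (auto simp: codes_def)
  have "code_term (Suc n) \<omega> = r (\<omega> 0) * code_term n (\<lambda>n. \<omega> (Suc n))" for n
    by (simp add: code_term_def prod.lessThan_Suc_shift del: prod.lessThan_Suc)
  then have "(\<Sum>n. code_term (Suc n) \<omega>) = r (\<omega> 0) * code_sum (\<lambda>n. \<omega> (Suc n))"
    unfolding code_sum_def by (simp add: suminf_mult summable_code_term[OF sh])
  then show ?thesis
    using suminf_split_head[OF summable_code_term[OF assms]]
    by (simp add: code_sum_def code_term_def)
qed

lemma attractor_eq: "attractor = (\<Union>i\<in>I. (\<lambda>x. b i + r i * x) ` attractor)"
proof (intro equalityI subsetI)
  fix x assume "x \<in> attractor"
  then obtain \<omega> where \<omega>: "\<omega> \<in> codes" "x = code_sum \<omega>" by (auto simp: attractor_def)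
  then have "(\<lambda>n. \<omega> (Suc n)) \<in> codes" "\<omega> 0 \<in> I" by (auto simp: codes_def)
  then show "x \<in> (\<Union>i\<in>I. (\<lambda>x. b i + r i * x) ` attractor)"
    using code_sum_unfold[OF \<omega>(1)] \<omega>(2) by (auto simp: attractor_def)
next
  fix x assume "x \<in> (\<Union>i\<in>I. (\<lambda>x. b i + r i * x) ` attractor)"
  then obtain i \<omega> where i: "i \<in> I" and \<omega>: "\<omega> \<in> codes" "x = b i + r i * code_sum \<omega>"
    by (auto simp: attractor_def)
  have "case_nat i \<omega> \<in> codes" using i \<omega>(1) by (auto simp: codes_def split: nat.split)
  moreover from code_sum_unfold[OF this] have "x = code_sum (case_nat i \<omega>)"
    using \<omega>(2) by simp
  ultimately show "x \<in> attractor" by (auto simp: attractor_def)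
qed

text \<open>The starting point does not matter, not even if it changes along with the length of
  the composition, as long as it stays bounded.\<close>
lemma code_sum_limit:
  assumes \<omega>: "\<omega> \<in> codes" and y: "bounded (range y)"
  shows "(\<lambda>N. (\<Sum>n<N. code_term n \<omega>) + (\<Prod>k<N. r (\<omega> k)) * y N) \<longlonglongrightarrow> code_sum \<omega>"
proof -
  obtain \<rho> where \<rho>: "0 \<le> \<rho>" "\<rho> < 1" "\<And>\<omega> n. \<omega> \<in> codes \<Longrightarrow> 0 < (\<Prod>k<n. r (\<omega> k))"
    "\<And>\<omega> n. \<omega> \<in> codes \<Longrightarrow> (\<Prod>k<n. r (\<omega> k)) \<le> \<rho> ^ n"
    using uniform_ratio by blast
  obtain Y where Y: "\<And>n. \<bar>y n\<bar> \<le> Y" using y by (auto simp: bounded_iff)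
  have "(\<lambda>N. (\<Prod>k<N. r (\<omega> k)) * y N) \<longlonglongrightarrow> 0"
  proof (rule Lim_null_comparison)
    show "\<forall>\<^sub>F N in sequentially. norm ((\<Prod>k<N. r (\<omega> k)) * y N) \<le> \<rho> ^ N * Y"
    proof (intro always_eventually allI)
      fix N
      have "norm ((\<Prod>k<N. r (\<omega> k)) * y N) = (\<Prod>k<N. r (\<omega> k)) * \<bar>y N\<bar>"
        using \<rho>(3)[OF \<omega>, of N] by (simp add: abs_mult)
      also have "\<dots> \<le> \<rho> ^ N * Y"
        using \<rho>(3,4)[OF \<omega>, of N] \<rho>(1) Y[of N] by (intro mult_mono) auto
      finally show "norm ((\<Prod>k<N. r (\<omega> k)) * y N) \<le> \<rho> ^ N * Y" .
    qed
    show "(\<lambda>N. \<rho> ^ N * Y) \<longlonglongrightarrow> 0"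
      using \<rho>(1,2) by (intro tendsto_mult_left_zero LIMSEQ_power_zero) auto
  qed
  moreover have "(\<lambda>N. \<Sum>n<N. code_term n \<omega>) \<longlonglongrightarrow> code_sum \<omega>"
    unfolding code_sum_def by (rule summable_LIMSEQ[OF summable_code_term[OF \<omega>]])
  ultimately show ?thesis
    using tendsto_add[of _ "code_sum \<omega>" sequentially _ 0] by simp
qed

text \<open>One inclusion follows an orbit inwards from any point of \<open>K\<close>; the other reads off an
  address of a given point by choosing preimages repeatedly.\<close>
lemma attractor_unique:
  assumes K: "K \<noteq> {}" "closed K" "bounded K"
    and inv: "K = (\<Union>i\<in>I. (\<lambda>x. b i + r i * x) ` K)"
  shows "attractor = K"
proof (intro equalityI subsetI)
  fix x assume "x \<in> attractor"
  then obtain \<omega> where \<omega>: "\<omega> \<in> codes" "x = code_sum \<omega>" by (auto simp: attractor_def)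
  obtain x0 where x0: "x0 \<in> K" using K(1) by auto
  have fin: "(\<Sum>n<N. code_term n \<omega>) + (\<Prod>k<N. r (\<omega> k)) * z \<in> K" if "z \<in> K" for z N
    using that
  proof (induction N arbitrary: z)
    case (Suc N)
    have "b (\<omega> N) + r (\<omega> N) * z \<in> K"
      using \<omega>(1) Suc.prems equalityD2[OF inv] by (auto simp: codes_def)
    from Suc.IH[OF this] show ?case
      by (simp add: code_term_def algebra_simps)
  qed auto
  have "bounded (range (\<lambda>_::nat. x0))" by auto
  from closed_sequentially[OF K(2) fin[OF x0] code_sum_limit[OF \<omega>(1) this]] show "x \<in> K"
    using \<omega>(2) by simp
next
  fix x assume x: "x \<in> K"
  have "\<exists>p. fst p \<in> I \<and> snd p \<in> K \<and> z = b (fst p) + r (fst p) * snd p" if z: "z \<in> K" for z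
  proof -
    from subsetD[OF equalityD1[OF inv] z]
    obtain i w where "i \<in> I" "w \<in> K" "z = b i + r i * w" by (elim UN_E imageE)
    then show ?thesis by (intro exI[of _ "(i, w)"]) simp
  qed
  then have "\<forall>z\<in>K. \<exists>p. fst p \<in> I \<and> snd p \<in> K \<and> z = b (fst p) + r (fst p) * snd p"
    by (intro ballI)
  then obtain p where p: "\<forall>z\<in>K. fst (p z) \<in> I \<and> snd (p z) \<in> K \<and>
      z = b (fst (p z)) + r (fst (p z)) * snd (p z)"
    by (rule bchoice[THEN exE])
  define f g where "f = fst \<circ> p" and "g = snd \<circ> p"
  have fg: "f z \<in> I \<and> g z \<in> K" and fg_eq: "b (f z) + r (f z) * g z = z" if "z \<in> K" for z
    using bspec[OF p that] by (auto simp: f_def g_def)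
  \<comment> \<open>\<open>f\<close> picks the piece that contains a point, and \<open>g\<close> the preimage in that piece.\<close>
  define y where "y n = (g ^^ n) x" for n
  have yK: "y n \<in> K" for n by (induction n) (auto simp: y_def x fg)
  define \<omega> where "\<omega> n = f (y n)" for n
  have \<omega>: "\<omega> \<in> codes" using yK fg by (auto simp: codes_def \<omega>_def)
  have y_Suc: "y n = b (\<omega> n) + r (\<omega> n) * y (Suc n)" for n
    using fg_eq[OF yK[of n]] by (simp add: \<omega>_def y_def)
  have expand: "(\<Sum>n<N. code_term n \<omega>) + (\<Prod>k<N. r (\<omega> k)) * y N = x" for N
  proof (induction N)
    case (Suc N)
    have "(\<Prod>k<N. r (\<omega> k)) * y N = code_term N \<omega> + (\<Prod>k<Suc N. r (\<omega> k)) * y (Suc N)"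
      by (subst y_Suc) (simp add: code_term_def algebra_simps)
    with Suc show ?case by simp
  qed (simp add: y_def)
  have "bounded (range y)" using yK by (intro bounded_subset[OF K(3)]) auto
  from code_sum_limit[OF \<omega> this] have "(\<lambda>N. x) \<longlonglongrightarrow> code_sum \<omega>"
    by (simp only: expand)
  then have "x = code_sum \<omega>" by (simp add: LIMSEQ_const_iff)
  then show "x \<in> attractor" using \<omega> by (auto simp: attractor_def)
qed

text \<open>If the pieces are pairwise disjoint, addresses are unique, and the coding map is a
  homeomorphism from the code space, which is compact, onto the attractor.\<close>
lemma inj_on_code_sum:
  assumes sep: "\<And>i j x y. i \<in> I \<Longrightarrow> j \<in> I \<Longrightarrow> x \<in> attractor \<Longrightarrow> y \<in> attractor \<Longrightarrow>
      b i + r i * x = b j + r j * y \<Longrightarrow> i = j"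
  shows "inj_on code_sum codes"
proof (rule inj_onI)
  have step: "\<omega> 0 = \<eta> 0 \<and> code_sum (\<lambda>n. \<omega> (Suc n)) = code_sum (\<lambda>n. \<eta> (Suc n))"
    if \<omega>: "\<omega> \<in> codes" and \<eta>: "\<eta> \<in> codes" and eq: "code_sum \<omega> = code_sum \<eta>" for \<omega> \<eta>
  proof -
    have sh: "\<omega> 0 \<in> I" "\<eta> 0 \<in> I"
        "code_sum (\<lambda>n. \<omega> (Suc n)) \<in> attractor" "code_sum (\<lambda>n. \<eta> (Suc n)) \<in> attractor"
      using \<omega> \<eta> by (auto simp: codes_def attractor_def)
    have eq': "b (\<omega> 0) + r (\<omega> 0) * code_sum (\<lambda>n. \<omega> (Suc n)) =
        b (\<eta> 0) + r (\<eta> 0) * code_sum (\<lambda>n. \<eta> (Suc n))"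
      using code_sum_unfold[OF \<omega>] code_sum_unfold[OF \<eta>] eq by simp
    then have "\<omega> 0 = \<eta> 0" by (rule sep[OF sh])
    then show ?thesis using eq' ratio_pos[OF sh(1)] by simp
  qed
  fix \<omega> \<eta> assume "\<omega> \<in> codes" "\<eta> \<in> codes" "code_sum \<omega> = code_sum \<eta>"
  then have "\<omega> n = \<eta> n" for n
  proof (induction n arbitrary: \<omega> \<eta>)
    case 0
    then show ?case using step by blast
  next
    case (Suc n)
    have "(\<lambda>n. \<omega> (Suc n)) \<in> codes" "(\<lambda>n. \<eta> (Suc n)) \<in> codes"
      using Suc.prems by (auto simp: codes_def)
    then show ?case using Suc.IH step[OF Suc.prems] by blast
  qed
  then show "\<omega> = \<eta>" by auto
qed

end

section \<open>Sets of expansions with restricted digits\<close>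

text \<open>The numbers with an expansion \<open>0.d\<^sub>1d\<^sub>2\<dots>\<close> in base \<open>q\<close>, all of whose digits lie in \<open>D\<close>.
  Digits may exceed \<open>q\<close>. The digit with index 0 is not used.\<close>
definition digit_set :: "real \<Rightarrow> nat set \<Rightarrow> real set" where
  "digit_set q D = {\<Sum>n. \<alpha> (Suc n) / q ^ Suc n | \<alpha>. \<forall>n\<ge>1. \<alpha> n \<in> real ` D}"

lemma affine_ifs_digits:
  assumes "1 < q" "finite D"
  shows "affine_ifs D (\<lambda>_. 1 / q)"
  using assms by unfold_locales auto

lemma digit_set_eq_attractor:
  assumes q: "1 < q" and D: "finite D"
  shows "digit_set q D = affine_ifs.attractor D (\<lambda>_. 1 / q) (\<lambda>d. real d / q)" (is "?L = ?R")
proof -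
  interpret affine_ifs D "\<lambda>_. 1 / q" "\<lambda>d. real d / q" using affine_ifs_digits[OF q D] .
  have sum: "code_sum \<omega> = (\<Sum>n. real (\<omega> n) / q ^ Suc n)" for \<omega>
    unfolding code_sum_def code_term_def by (intro suminf_cong) (simp add: field_simps)
  show ?thesis
  proof (intro equalityI subsetI)
    fix x assume "x \<in> ?L"
    then obtain \<alpha> :: "nat \<Rightarrow> real" where \<alpha>: "\<forall>n\<ge>1. \<alpha> n \<in> real ` D" "x = (\<Sum>n. \<alpha> (Suc n) / q ^ Suc n)"
      unfolding digit_set_def by blast
    then have "\<forall>n. \<exists>d. d \<in> D \<and> \<alpha> (Suc n) = real d" by fastforce
    then obtain \<omega> where "\<And>n. \<omega> n \<in> D" "\<And>n. \<alpha> (Suc n) = real (\<omega> n)" by metis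
    then show "x \<in> ?R" unfolding attractor_def using \<alpha>(2) sum[of \<omega>]
      by (intro image_eqI[of _ _ \<omega>]) (auto simp: codes_def)
  next
    fix x assume "x \<in> ?R"
    then obtain \<omega> where \<omega>: "\<omega> \<in> codes" "x = code_sum \<omega>" by (auto simp: attractor_def)
    then show "x \<in> ?L"
      unfolding digit_set_def by (intro CollectI exI[of _ "\<lambda>n. real (\<omega> (n - 1))"]) (auto simp: sum codes_def)
  qed
qed

lemma compact_digit_set:
  assumes "1 < q" "finite D"
  shows "compact (digit_set q D)"
  unfolding digit_set_eq_attractor[OF assms]
  by (rule affine_ifs.compact_attractor[OF affine_ifs_digits[OF assms]])

lemma digit_set_eq:
  assumes "1 < q" "finite D"
  shows "digit_set q D = (\<Union>d\<in>D. (\<lambda>x. (x + real d) / q) ` digit_set q D)"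
proof -
  have piece: "(\<lambda>x. real d / q + 1 / q * x) = (\<lambda>x. (x + real d) / q)" for d
    by (auto simp: add_divide_distrib)
  show ?thesis
    using affine_ifs.attractor_eq[OF affine_ifs_digits[OF assms], where b = "\<lambda>d. real d / q"]
    unfolding digit_set_eq_attractor[OF assms] by (simp only: piece)
qed

lemma digit_set_step:
  assumes "1 < q" "finite D" "d \<in> D" "x \<in> digit_set q D"
  shows "(x + real d) / q \<in> digit_set q D"
  using assms(3,4) equalityD2[OF digit_set_eq[OF assms(1,2)]] by blast

lemma digit_set_cases:
  assumes "1 < q" "finite D" "x \<in> digit_set q D"
  obtains d y where "d \<in> D" "y \<in> digit_set q D" "x = (y + real d) / q"
  using subsetD[OF equalityD1[OF digit_set_eq[OF assms(1,2)]] assms(3)] by blast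

text \<open>The way in which digit sets are recognised below: it is enough to verify the
  self-similarity.\<close>
lemma digit_set_unique:
  assumes "1 < q" "finite D" and K: "K \<noteq> {}" "closed K" "bounded K"
    and inv: "K = (\<Union>d\<in>D. (\<lambda>x. (x + real d) / q) ` K)"
  shows "digit_set q D = K"
proof -
  have piece: "(\<lambda>x. real d / q + 1 / q * x) = (\<lambda>x. (x + real d) / q)" for d
    by (auto simp: add_divide_distrib)
  have "K = (\<Union>d\<in>D. (\<lambda>x. real d / q + 1 / q * x) ` K)"
    unfolding piece by (rule inv)
  then show ?thesis
    unfolding digit_set_eq_attractor[OF assms(1,2)]
    by (rule affine_ifs.attractor_unique[OF affine_ifs_digits[OF assms(1,2)] K])
qed

lemma repeated_digit_in_digit_set:
  assumes "1 < q" "d \<in> D"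
  shows "real d / (q - 1) \<in> digit_set q D"
proof -
  have "(\<lambda>n. (1 / q) ^ n) sums (1 / (1 - 1 / q))"
    using assms by (intro geometric_sums) auto
  from sums_mult[OF this, of "real d / q"]
  have "(\<lambda>n. real d / q ^ Suc n) sums (real d / (q - 1))"
    using assms by (simp add: field_simps)
  then show ?thesis
    using assms unfolding digit_set_def
    by (intro CollectI exI[of _ "\<lambda>_. real d"]) (auto simp: sums_iff)
qed

lemma digit_set_bounds:
  assumes q: "1 < q" and D: "finite D" "\<And>d. d \<in> D \<Longrightarrow> d \<le> m"
    and x: "x \<in> digit_set q D"
  shows "0 \<le> x" "x \<le> real m / (q - 1)"
proof -
  have ne: "digit_set q D \<noteq> {}" using x by auto
  \<comment> \<open>The least element \<open>u\<close> satisfies \<open>q * u = y + d \<ge> u\<close>; the greatest is treated likewise.\<close>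
  obtain u where u: "u \<in> digit_set q D" "\<And>y. y \<in> digit_set q D \<Longrightarrow> u \<le> y"
    using compact_attains_inf[OF compact_digit_set[OF q D(1)] ne] by auto
  obtain d y where "d \<in> D" "y \<in> digit_set q D" "u = (y + real d) / q"
    using digit_set_cases[OF q D(1) u(1)] .
  then have "q * u \<ge> u" using u(2)[of y] q by (simp add: field_simps)
  then have "0 \<le> (q - 1) * u" by (simp add: algebra_simps)
  then have "0 \<le> u" using q by (simp add: zero_le_mult_iff)
  then show "0 \<le> x" using u(2)[OF x] by simp
  obtain v where v: "v \<in> digit_set q D" "\<And>y. y \<in> digit_set q D \<Longrightarrow> y \<le> v"
    using compact_attains_sup[OF compact_digit_set[OF q D(1)] ne] by auto
  obtain d y where "d \<in> D" "y \<in> digit_set q D" "v = (y + real d) / q"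
    using digit_set_cases[OF q D(1) v(1)] .
  then have "q * v \<le> v + real m" using v(2)[of y] D(2)[of d] q by (simp add: field_simps)
  then have "v \<le> real m / (q - 1)" using q by (simp add: field_simps)
  then show "x \<le> real m / (q - 1)" using v(2)[OF x] by simp
qed

lemma unit_interval_eq_digit_set: "digit_set 3 {0,1,2} = {0..1}"
proof (rule digit_set_unique)
  show "{0..1::real} = (\<Union>d\<in>{0,1,2}. (\<lambda>x. (x + real d) / 3) ` {0..1})"
  proof (intro equalityI subsetI)
    fix x :: real assume x: "x \<in> {0..1}"
    consider "x \<le> 1/3" | "1/3 \<le> x" "x \<le> 2/3" | "2/3 \<le> x" by linarith
    then show "x \<in> (\<Union>d\<in>{0,1,2}. (\<lambda>x. (x + real d) / 3) ` {0..1})"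
    proof cases
      case 1
      then have "x \<in> (\<lambda>x. (x + real 0) / 3) ` {0..1}"
        using x by (intro image_eqI[of _ _ "3 * x"]) auto
      then show ?thesis by blast
    next
      case 2
      then have "x \<in> (\<lambda>x. (x + real 1) / 3) ` {0..1}"
        using x by (intro image_eqI[of _ _ "3 * x - 1"]) auto
      then show ?thesis by blast
    next
      case 3
      then have "x \<in> (\<lambda>x. (x + real 2) / 3) ` {0..1}"
        using x by (intro image_eqI[of _ _ "3 * x - 2"]) auto
      then show ?thesis by blast
    qed
  qed auto
qed auto

section \<open>The tile and its overlaps with its integer translates\<close>

text \<open>The set of subsums itself, and the set of base 4 expansions of which two translates turn
  out to make up its boundary.\<close>
definition tile :: "real set" where "tile = digit_set 4 {0,2,3,5}"
definition edge :: "real set" where "edge = digit_set 4 {0,1,2}"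

lemma compact_tile: "compact tile" unfolding tile_def by (rule compact_digit_set) auto
lemma compact_edge: "compact edge" unfolding edge_def by (rule compact_digit_set) auto

lemma tile_step: "d \<in> {0,2,3,5} \<Longrightarrow> x \<in> tile \<Longrightarrow> (x + real d) / 4 \<in> tile"
  unfolding tile_def by (rule digit_set_step) auto

lemma tile_cases:
  assumes "x \<in> tile"
  obtains d y where "d \<in> {0,2,3,5}" "y \<in> tile" "x = (y + real d) / 4"
  using digit_set_cases[of 4 "{0,2,3,5}" x] assms unfolding tile_def by auto

lemma tile_bounds: "x \<in> tile \<Longrightarrow> 0 \<le> x \<and> x \<le> 5/3"
  using digit_set_bounds(1)[of 4 "{0,2,3,5}" 5 x] digit_set_bounds(2)[of 4 "{0,2,3,5}" 5 x]
  unfolding tile_def by force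

lemma edge_bounds: "x \<in> edge \<Longrightarrow> 0 \<le> x \<and> x \<le> 2/3"
  using digit_set_bounds(1)[of 4 "{0,1,2}" 2 x] digit_set_bounds(2)[of 4 "{0,1,2}" 2 x]
  unfolding edge_def by force

lemma zero_in_tile: "0 \<in> tile"
  using repeated_digit_in_digit_set[of 4 0 "{0,2,3,5}"] by (simp add: tile_def)

lemma one_in_tile: "1 \<in> tile"
  using repeated_digit_in_digit_set[of 4 3 "{0,2,3,5}"] by (simp add: tile_def)

text \<open>Comparing leading digits in \<open>y = (u + c) / 4\<close> and \<open>y + 1 = (v + d) / 4\<close> gives
  \<open>v = u + (4 + c - d)\<close>. Both \<open>u\<close> and \<open>v\<close> lie in \<open>{0..5/3}\<close>, so the carry \<open>4 + c - d\<close> is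
  \<open>1\<close> or \<open>-1\<close>, the value \<open>0\<close> not being attained by these digits. The three possible
  digit pairs reproduce the overlap with the digits \<open>0\<close>, \<open>1\<close> and \<open>2\<close>.\<close>
lemma edge_eq_overlap: "edge = {x \<in> tile. x + 1 \<in> tile}"
  unfolding edge_def
proof (rule digit_set_unique)
  let ?P = "{x \<in> tile. x + 1 \<in> tile}"
  have P: "?P = tile \<inter> (\<lambda>x. x - 1) ` tile"
    by (auto intro: image_eqI[of _ _ "_ + 1"])
  show "?P \<noteq> {}" using zero_in_tile one_in_tile by auto
  have "compact ?P"
    unfolding P by (intro compact_Int compact_continuous_image compact_tile continuous_intros)
  then show "closed ?P" "bounded ?P" by (auto dest: compact_imp_closed compact_imp_bounded)
  show "?P = (\<Union>d\<in>{0,1,2}. (\<lambda>x. (x + real d) / 4) ` ?P)"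
  proof (intro equalityI subsetI)
    fix y assume "y \<in> ?P"
    then have y: "y \<in> tile" "y + 1 \<in> tile" by auto
    obtain c u where c: "c \<in> {0,2,3,5}" "u \<in> tile" "y = (u + real c) / 4"
      by (rule tile_cases[OF y(1)])
    obtain d v where d: "d \<in> {0,2,3,5}" "v \<in> tile" "y + 1 = (v + real d) / 4"
      by (rule tile_cases[OF y(2)])
    have v: "v = u + (4 + real c - real d)" using c(3) d(3) by simp
    note b = tile_bounds[OF c(2)] tile_bounds[OF d(2)]
    consider "c = 0" "d = 5" | "c = 0" "d = 3" | "c = 2" "d = 5"
      using c(1) d(1) b v by auto
    then show "y \<in> (\<Union>d\<in>{0,1,2}. (\<lambda>x. (x + real d) / 4) ` ?P)"
    proof cases
      case 1
      then have "v \<in> ?P" "y = (v + real 1) / 4" using c d v by auto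
      then show ?thesis by blast
    next
      case 2
      then have "u \<in> ?P" "y = (u + real 0) / 4" using c d v by (auto simp: add.commute)
      then show ?thesis by blast
    next
      case 3
      then have "u \<in> ?P" "y = (u + real 2) / 4" using c d v by (auto simp: add.commute)
      then show ?thesis by blast
    qed
  next
    fix y assume "y \<in> (\<Union>d\<in>{0,1,2}. (\<lambda>x. (x + real d) / 4) ` ?P)"
    then obtain d x where d: "d \<in> {0,1,2}" and x: "x \<in> tile" "x + 1 \<in> tile" and y: "y = (x + real d) / 4"
      by blast
    consider "y = (x + real 0) / 4" "y + 1 = (x + 1 + real 3) / 4"
      | "y = (x + 1 + real 0) / 4" "y + 1 = (x + real 5) / 4"
      | "y = (x + real 2) / 4" "y + 1 = (x + 1 + real 5) / 4"
      using d y by (auto simp: field_simps)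
    then show "y \<in> ?P"
      by cases (simp_all only: mem_Collect_eq tile_step x insert_iff simp_thms)
  qed
qed auto

text \<open>The digits \<open>0, 5, 2, 3\<close> form a complete system of residues modulo 4. This is why the
  integer translates of the tile cover the line.\<close>
lemma complete_residues_mod_4:
  obtains d k' where "d \<in> {0,2,3,5::nat}" "(k::int) = int d + 4 * k'"
proof -
  have "k mod 4 \<in> {0,1,2,3}" by auto
  then consider "k = 4 * (k div 4)" | "k = 5 + 4 * (k div 4 - 1)" | "k = 2 + 4 * (k div 4)"
      | "k = 3 + 4 * (k div 4)"
    using div_mult_mod_eq[of k 4] by fastforce
  then show ?thesis
    by cases (use that[of 0 "k div 4"] that[of 5 "k div 4 - 1"] that[of 2 "k div 4"]
        that[of 3 "k div 4"] in auto)
qed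

lemma tile_covers_grid: "\<exists>k::int. real_of_int m / 4 ^ n - real_of_int k \<in> tile"
proof (induction n arbitrary: m)
  case 0
  then show ?case using zero_in_tile by (intro exI[of _ m]) simp
next
  case (Suc n)
  obtain k :: int where k: "real_of_int m / 4 ^ n - real_of_int k \<in> tile" using Suc by blast
  obtain d k' where d: "d \<in> {0,2,3,5::nat}" "k = int d + 4 * k'"
    by (rule complete_residues_mod_4)
  from d(2) have k': "real_of_int k = real d + 4 * real_of_int k'" by simp
  have "real_of_int m / 4 ^ Suc n - real_of_int k' = (real_of_int m / 4 ^ n - real_of_int k + real d) / 4"
    unfolding k' by (simp add: field_simps)
  then show ?case using tile_step[OF d(1) k] by metis
qed

text \<open>Every grid point \<open>m / 4 ^ n\<close> is covered. Only finitely many translates of the compact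
  tile meet a bounded region, so their union is closed, and the grid points are dense.\<close>
lemma tile_covers: "\<exists>k::int. y - real_of_int k \<in> tile"
proof -
  have lower: "y - (1/4) ^ n < real_of_int \<lfloor>y * 4 ^ n\<rfloor> / 4 ^ n" for n
  proof -
    have "y * 4 ^ n - 1 < real_of_int \<lfloor>y * 4 ^ n\<rfloor>" by linarith
    then have "(y * 4 ^ n - 1) / 4 ^ n < real_of_int \<lfloor>y * 4 ^ n\<rfloor> / 4 ^ n"
      by (rule divide_strict_right_mono) simp
    then show ?thesis by (simp add: diff_divide_distrib power_one_over)
  qed
  define K where "K = {\<lfloor>y\<rfloor> - 3..\<lfloor>y\<rfloor> + 1}"
  define F where "F = (\<Union>k\<in>K. (\<lambda>x. real_of_int k + x) ` tile)"
  have "closed F" unfolding F_def K_def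
    by (intro closed_UN ballI compact_imp_closed compact_translation compact_tile) auto
  moreover have "real_of_int \<lfloor>y * 4 ^ n\<rfloor> / 4 ^ n \<in> F" for n
  proof -
    obtain k where k: "real_of_int \<lfloor>y * 4 ^ n\<rfloor> / 4 ^ n - real_of_int k \<in> tile"
      using tile_covers_grid by blast
    have "real_of_int \<lfloor>y * 4 ^ n\<rfloor> / 4 ^ n \<le> y" by (simp add: field_simps)
    moreover have "(1/4) ^ n \<le> (1::real)" by (simp add: power_le_one)
    ultimately have "y - 8/3 \<le> real_of_int k" "real_of_int k \<le> y"
      using tile_bounds[OF k] lower[of n] by linarith+
    then have "k \<in> K" unfolding K_def by simp linarith
    then show ?thesis using k unfolding F_def by force
  qed
  moreover have "(\<lambda>n. real_of_int \<lfloor>y * 4 ^ n\<rfloor> / 4 ^ n) \<longlonglongrightarrow> y"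
  proof (rule tendsto_sandwich[of "\<lambda>n. y - (1/4) ^ n"])
    show "\<forall>\<^sub>F n in sequentially. y - (1/4) ^ n \<le> real_of_int \<lfloor>y * 4 ^ n\<rfloor> / 4 ^ n"
      using lower by (intro always_eventually allI less_imp_le)
    show "\<forall>\<^sub>F n in sequentially. real_of_int \<lfloor>y * 4 ^ n\<rfloor> / 4 ^ n \<le> y"
      by (intro always_eventually allI) (simp add: field_simps)
    show "(\<lambda>n. y - (1/4) ^ n) \<longlonglongrightarrow> y"
      using tendsto_diff[OF tendsto_const LIMSEQ_power_zero[of "1/4::real"], of y] by simp
  qed auto
  ultimately have "y \<in> F" by (rule closed_sequentially)
  then obtain k x where "x \<in> tile" "y = real_of_int k + x" unfolding F_def by blast
  then show ?thesis by (intro exI[of _ k]) simp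
qed

text \<open>No other translate of the tile reaches the gap between \<open>tile - 1\<close> and \<open>tile + 1\<close>.\<close>
lemma open_unit_gap_subset_tile: "{2/3<..<1} \<subseteq> tile"
proof
  fix y :: real assume y: "y \<in> {2/3<..<1}"
  obtain k :: int where k: "y - real_of_int k \<in> tile" using tile_covers by blast
  have "real_of_int k < 1" "real_of_int k > -1" using tile_bounds[OF k] y by auto
  then have "k = 0" by linarith
  then show "y \<in> tile" using k by simp
qed

lemma interior_tile_dense: "tile \<subseteq> closure (interior tile)"
proof
  fix x assume x: "x \<in> tile"
  \<comment> \<open>Every point lies in arbitrarily small copies of the tile, each of which has interior points.\<close>
  have near: "\<exists>z\<in>interior tile. \<bar>z - x\<bar> \<le> (1/4) ^ n * 5/3" if "x \<in> tile" for x n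
    using that
  proof (induction n arbitrary: x)
    case 0
    have "5/6 \<in> interior tile"
      using interior_maximal[OF open_unit_gap_subset_tile] by auto
    moreover have "\<bar>5/6 - x\<bar> \<le> 5/3" using tile_bounds[OF 0] by linarith
    ultimately show ?case by (intro bexI[of _ "5/6"]) simp_all
  next
    case (Suc n)
    obtain d y where d: "d \<in> {0,2,3,5}" "y \<in> tile" "x = (y + real d) / 4"
      by (rule tile_cases[OF Suc.prems])
    obtain z where z: "z \<in> interior tile" "\<bar>z - y\<bar> \<le> (1/4) ^ n * 5/3"
      using Suc.IH[OF d(2)] by blast
    have "open ((\<lambda>x. real d / 4 + x) ` ((*\<^sub>R) (1/4) ` interior tile))"
      by (intro open_translation open_scaling) auto
    moreover have "(\<lambda>x. real d / 4 + x) ` ((*\<^sub>R) (1/4) ` interior tile) \<subseteq> tile"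
      using tile_step[OF d(1)] interior_subset by (fastforce simp: add_divide_distrib add.commute)
    ultimately have "(\<lambda>x. real d / 4 + x) ` ((*\<^sub>R) (1/4) ` interior tile) \<subseteq> interior tile"
      by (rule interior_maximal[rotated])
    then have "real d / 4 + (1/4) * z \<in> interior tile" using z(1) by auto
    moreover have "\<bar>real d / 4 + (1/4) * z - x\<bar> \<le> (1/4) ^ Suc n * 5/3"
    proof -
      have "real d / 4 + (1/4) * z - x = (z - y) / 4" unfolding d(3) by (simp add: field_simps)
      then have "\<bar>real d / 4 + (1/4) * z - x\<bar> = \<bar>z - y\<bar> / 4" by (simp only: abs_divide abs_numeral)
      also have "\<dots> \<le> (1/4) ^ Suc n * 5/3" using z(2) by simp
      finally show ?thesis .
    qed
    ultimately show ?case by blast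
  qed
  show "x \<in> closure (interior tile)"
    unfolding closure_approachable
  proof (intro allI impI)
    fix e :: real assume e: "0 < e"
    obtain n where "(1/4) ^ n < e * 3/5" using real_arch_pow_inv[of "e * 3/5" "1/4"] e by auto
    then have "(1/4) ^ n * 5/3 < e" by simp
    then show "\<exists>z\<in>interior tile. dist z x < e"
      using near[OF x, of n] by (force simp: dist_real_def)
  qed
qed

text \<open>The set consists of three copies of itself, each scaled by \<open>1/4\<close>.\<close>
lemma null_edge: "edge \<in> null_sets lebesgue"
proof -
  have lm: "edge \<in> sets lebesgue" using compact_edge by (simp add: lmeasurable_compact fmeasurableD)
  have piece: "(\<lambda>x. (x + real d) / 4) ` edge \<in> sets lebesgue"
      "emeasure lebesgue ((\<lambda>x. (x + real d) / 4) ` edge) = ennreal (1/4) * emeasure lebesgue edge" for d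
  proof -
    have "compact ((\<lambda>x. (x + real d) / 4) ` edge)"
      by (intro compact_continuous_image compact_edge continuous_intros) auto
    then show "(\<lambda>x. (x + real d) / 4) ` edge \<in> sets lebesgue"
      by (simp add: lmeasurable_compact fmeasurableD)
    have eq: "(\<lambda>x. (x + real d) / 4) = (\<lambda>x. real d / 4 + (1/4) *\<^sub>R x)" by (auto simp: field_simps)
    show "emeasure lebesgue ((\<lambda>x. (x + real d) / 4) ` edge) = ennreal (1/4) * emeasure lebesgue edge"
      unfolding eq using emeasure_lebesgue_affine[of "1/4" "real d / 4" edge]
      by (simp add: add.commute)
  qed
  have edge: "edge = (\<Union>d\<in>{0,1,2}. (\<lambda>x. (x + real d) / 4) ` edge)"
    unfolding edge_def by (rule digit_set_eq) auto
  have "emeasure lebesgue edge = emeasure lebesgue (\<Union>d\<in>{0,1,2}. (\<lambda>x. (x + real d) / 4) ` edge)"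
    by (rule arg_cong[OF edge])
  also have "\<dots> \<le> (\<Sum>d\<in>{0,1,2}. emeasure lebesgue ((\<lambda>x. (x + real d) / 4) ` edge))"
    by (intro emeasure_subadditive_finite image_subsetI piece(1)) simp
  also have "\<dots> = (\<Sum>d\<in>{0,1,2::nat}. ennreal (1/4) * emeasure lebesgue edge)"
    by (intro sum.cong refl piece(2))
  finally have le: "emeasure lebesgue edge \<le> (\<Sum>d\<in>{0,1,2::nat}. ennreal (1/4) * emeasure lebesgue edge)" .
  have em: "emeasure lebesgue edge = ennreal (measure lebesgue edge)"
    using compact_edge by (simp add: emeasure_eq_measure2 lmeasurable_compact)
  have "ennreal (measure lebesgue edge) \<le> 3 * ennreal (1/4 * measure lebesgue edge)"
    using le unfolding em by (simp add: ennreal_mult[symmetric])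
  also have "\<dots> = ennreal (3 * (1/4 * measure lebesgue edge))"
    by (subst ennreal_mult) auto
  finally have "measure lebesgue edge \<le> 3 * (1/4 * measure lebesgue edge)"
    by (subst (asm) ennreal_le_iff) auto
  then have "measure lebesgue edge = 0"
    using measure_nonneg[of lebesgue edge] by simp
  then show ?thesis using lm em by (auto simp: null_sets_def)
qed

text \<open>A boundary point is a limit of points outside the tile, hence lies in another
  translate. Conversely, a translate meeting the interior of the tile would share an open
  set with it, whereas the overlaps are null sets.\<close>
lemma frontier_tile: "frontier tile = edge \<union> (\<lambda>x. x + 1) ` edge"
proof (intro equalityI subsetI)
  fix x assume x: "x \<in> frontier tile"
  have closed: "closed tile" by (rule compact_imp_closed[OF compact_tile])
  have xt: "x \<in> tile" using x closed frontier_subset_eq by blast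
  \<comment> \<open>A point outside the tile, at distance less than 1 from it, can only lie in these translates.\<close>
  define F where "F = (\<Union>k\<in>{-3..3} - {0::int}. (\<lambda>x. real_of_int k + x) ` tile)"
  have "closed F" unfolding F_def
    by (intro closed_UN ballI compact_imp_closed compact_translation compact_tile) auto
  moreover have "x \<in> closure F"
    unfolding closure_approachable
  proof (intro allI impI)
    fix e :: real assume e: "0 < e"
    have "\<not> ball x (min e 1) \<subseteq> tile"
      using x e mem_interior[of x tile] unfolding frontier_def
      by (metis DiffD2 min_less_iff_conj zero_less_one)
    then obtain y where "y \<in> ball x (min e 1)" and "y \<notin> tile" by blast
    then have y: "y \<notin> tile" "dist x y < e" "dist x y < 1" by simp_all
    obtain k :: int where k: "y - real_of_int k \<in> tile" using tile_covers by blast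
    have "k \<noteq> 0" using k y(1) by auto
    moreover have "real_of_int k < 4" "real_of_int k > -4"
      using tile_bounds[OF k] tile_bounds[OF xt] y(3) by (auto simp: dist_real_def)
    then have "k \<in> {-3..3}" by auto
    ultimately have "y \<in> F" using k unfolding F_def by force
    then show "\<exists>y\<in>F. dist y x < e" using y(2) by (auto simp: dist_commute)
  qed
  ultimately have "x \<in> F" by simp
  then obtain k :: int where k: "k \<noteq> 0" "x - real_of_int k \<in> tile" unfolding F_def by force
  have "real_of_int k < 2" "real_of_int k > -2"
    using tile_bounds[OF k(2)] tile_bounds[OF xt] by auto
  then have "k = 1 \<or> k = -1" using k(1) by auto
  then show "x \<in> edge \<union> (\<lambda>x. x + 1) ` edge"
  proof
    assume "k = 1"
    then have "x - 1 \<in> edge" using k(2) xt by (simp add: edge_eq_overlap)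
    then show ?thesis by force
  next
    assume "k = -1"
    then show ?thesis using k(2) xt by (simp add: edge_eq_overlap)
  qed
next
  have disj: "interior tile \<inter> (\<lambda>x. x + c) ` tile = {}"
    if c: "tile \<inter> (\<lambda>x. x + c) ` tile \<in> null_sets lebesgue" for c
  proof (rule ccontr)
    assume "interior tile \<inter> (\<lambda>x. x + c) ` tile \<noteq> {}"
    then obtain y where y: "y \<in> tile" "y + c \<in> interior tile" by auto
    \<comment> \<open>Translating by \<open>c\<close> an open set of interior points near \<open>y\<close> lands in the overlap.\<close>
    define W where "W = (\<lambda>x. x - c) ` interior tile \<inter> interior tile"
    have "open ((\<lambda>x. x - c) ` interior tile)" by (intro open_translation_subtract open_interior)
    moreover have "y \<in> (\<lambda>x. x - c) ` interior tile" using y(2) by force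
    moreover have "y \<in> closure (interior tile)" using interior_tile_dense y(1) by auto
    ultimately have "W \<noteq> {}" unfolding W_def using open_Int_closure_eq_empty by blast
    moreover have "open W" unfolding W_def by (intro open_Int open_translation_subtract open_interior)
    ultimately have "(\<lambda>x. c + x) ` W \<noteq> {}" "open ((\<lambda>x. c + x) ` W)" by (auto intro: open_translation)
    moreover have "(\<lambda>x. c + x) ` W \<subseteq> tile \<inter> (\<lambda>x. x + c) ` tile"
    proof
      fix z assume "z \<in> (\<lambda>x. c + x) ` W"
      then have "z \<in> interior tile" "z - c \<in> interior tile" unfolding W_def by auto
      then have "z \<in> tile" "z - c \<in> tile" using interior_subset by auto
      then show "z \<in> tile \<inter> (\<lambda>x. x + c) ` tile" by (auto intro: image_eqI[of _ _ "z - c"])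
    qed
    then have "negligible ((\<lambda>x. c + x) ` W)"
      using c negligible_iff_null_sets negligible_subset by blast
    ultimately show False using open_not_negligible by blast
  qed
  have closed: "closed tile" by (rule compact_imp_closed[OF compact_tile])
  have shift: "(\<lambda>x. x + 1) ` edge \<in> null_sets lebesgue"
    using negligible_translation[of edge 1] null_edge
    by (simp add: negligible_iff_null_sets add.commute)
  have eq: "tile \<inter> (\<lambda>x. x + 1) ` tile = (\<lambda>x. x + 1) ` edge"
      "tile \<inter> (\<lambda>x. x + -1) ` tile = edge"
    unfolding edge_eq_overlap by (auto intro: image_eqI[of _ _ "_ + 1"])
  fix x assume "x \<in> edge \<union> (\<lambda>x. x + 1) ` edge"
  then have "x \<in> tile" "x \<notin> interior tile"
    using disj[of 1] disj[of "-1"] shift null_edge unfolding eq by (auto simp flip: eq) 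
  then show "x \<in> frontier tile" using closed by (simp add: frontier_def)
qed

section \<open>Lebesgue measure and the intervals of the interior\<close>

text \<open>Reducing the tile modulo 1 covers \<open>{0..<1}\<close> exactly once up to a null set.\<close>

lemma emeasure_tile: "emeasure lebesgue tile = 1"
proof -
  let ?L = "tile \<inter> {0..<1}" and ?R = "tile \<inter> {1..<2}"
  let ?R' = "(\<lambda>x. x - 1) ` ?R"
  have mt: "tile \<in> sets lebesgue" using compact_tile by (simp add: lmeasurable_compact fmeasurableD)
  have L: "?L \<in> sets lebesgue" and R: "?R \<in> sets lebesgue" using mt by auto
  have "(\<lambda>x. x - 1) = (\<lambda>x::real. -1 + x)" by auto
  then have R': "?R' \<in> sets lebesgue" by (simp only: lebesgue_sets_translation[OF R])
  have eR: "emeasure lebesgue ?R' = emeasure lebesgue ?R"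
    using emeasure_lebesgue_affine[of 1 "-1" ?R] by (simp add: algebra_simps)
  have "tile = ?L \<union> ?R" using tile_bounds by force
  then have "emeasure lebesgue tile = emeasure lebesgue (?L \<union> ?R)" by simp
  also have "\<dots> = emeasure lebesgue ?L + emeasure lebesgue ?R"
    using L R by (subst plus_emeasure) auto
  also have "\<dots> = emeasure lebesgue ?L + emeasure lebesgue ?R'" by (simp add: eR)
  also have "\<dots> = emeasure lebesgue (?L \<union> ?R') + emeasure lebesgue (?L \<inter> ?R')"
    by (rule emeasure_Un_Int[OF L R'])
  also have "?L \<union> ?R' = {0..<1}"
  proof (intro equalityI subsetI)
    fix y :: real assume y: "y \<in> {0..<1}"
    obtain k :: int where k: "y - real_of_int k \<in> tile" using tile_covers by blast
    have "real_of_int k < 1" "real_of_int k > -2" using tile_bounds[OF k] y by auto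
    then have "k = 0 \<or> k = -1" by auto
    then show "y \<in> ?L \<union> ?R'"
      using k y by (auto intro: image_eqI[of _ _ "y + 1"])
  qed auto
  also have "?L \<inter> ?R' \<subseteq> edge" by (auto simp: edge_eq_overlap)
  then have "emeasure lebesgue (?L \<inter> ?R') = 0"
    using null_edge L R' by (metis null_sets_subset null_setsD1 sets.Int)
  finally show ?thesis by simp
qed

lemma null_frontier_tile: "frontier tile \<in> null_sets lebesgue"
  using negligible_translation[of edge 1] null_edge
  unfolding frontier_tile by (auto simp: negligible_iff_null_sets add.commute)

lemma emeasure_interior_tile: "emeasure lebesgue (interior tile) = 1"
proof -
  have "interior tile = tile - frontier tile"
    using interior_subset compact_imp_closed[OF compact_tile] by (auto simp: frontier_def)
  moreover have "tile \<in> sets lebesgue"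
    using compact_tile by (simp add: lmeasurable_compact fmeasurableD)
  ultimately show ?thesis
    using emeasure_Diff_null_set[OF null_frontier_tile] emeasure_tile by simp
qed

lemma infinite_frontier_tile: "infinite (frontier tile)"
proof
  assume "finite (frontier tile)"
  then have fin: "finite edge" unfolding frontier_tile by simp
  have ne: "edge \<noteq> {}" using repeated_digit_in_digit_set[of 4 0 "{0,1,2}"] by (auto simp: edge_def)
  have step: "(x + real d) / 4 \<in> edge" if "d \<in> {0,1,2}" "x \<in> edge" for d x
    using that unfolding edge_def by (intro digit_set_step) auto
  \<comment> \<open>A finite nonempty set cannot contain three disjoint copies of itself.\<close>
  have "3 * card edge = card ((\<lambda>(d, x). (x + real d) / 4) ` ({0,1,2} \<times> edge))"
  proof (subst card_image)
    show "inj_on (\<lambda>(d, x). (x + real d) / 4) ({0,1,2} \<times> edge)"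
    proof (rule inj_onI, clarsimp simp only: prod.case mem_Sigma_iff split_paired_all)
      fix d e :: nat and x y
      assume *: "d \<in> {0,1,2}" "e \<in> {0,1,2}" "x \<in> edge" "y \<in> edge" "(x + real d) / 4 = (y + real e) / 4"
      then have "d = e" using edge_bounds[of x] edge_bounds[of y] by auto
      then show "d = e \<and> x = y" using * by simp
    qed
  qed (simp add: card_cartesian_product)
  also have "\<dots> \<le> card edge"
    using step by (intro card_mono fin) auto
  finally show False using ne fin by simp
qed

lemma open_connected_real_interval:
  fixes c :: "real set"
  assumes "open c" "connected c" "bounded c" "c \<noteq> {}"
  shows "c = {Inf c<..<Sup c}"
proof (intro equalityI subsetI)
  have bd: "bdd_below c" "bdd_above c"
    using assms(3) by (auto simp: bounded_imp_bdd_below bounded_imp_bdd_above)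
  fix x assume x: "x \<in> c"
  then obtain e where e: "e > 0" "ball x e \<subseteq> c" using assms(1) openE by blast
  have "x - e/2 \<in> c" "x + e/2 \<in> c" using e by (auto intro!: subsetD[OF e(2)] simp: dist_real_def)
  then have "Inf c \<le> x - e/2" "x + e/2 \<le> Sup c" using bd by (auto intro: cInf_lower cSup_upper)
  then show "x \<in> {Inf c<..<Sup c}" using e(1) by auto
next
  have bd: "bdd_below c" "bdd_above c"
    using assms(3) by (auto simp: bounded_imp_bdd_below bounded_imp_bdd_above)
  fix x assume x: "x \<in> {Inf c<..<Sup c}"
  obtain u where u: "u \<in> c" "u < x" using x cInf_less_iff[OF assms(4) bd(1)] by auto
  obtain v where v: "v \<in> c" "x < v" using x less_cSup_iff[OF assms(4) bd(2)] by auto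
  show "x \<in> c" using connectedD_interval[OF assms(2) u(1) v(1)] u v by simp
qed

text \<open>The components are countably many open intervals. If there were only finitely many, the
  boundary would consist of their endpoints.\<close>
lemma open_set_infinitely_many_intervals:
  fixes S :: "real set"
  assumes S: "open S" "bounded S" and inf: "infinite (frontier S)"
  obtains a b :: "nat \<Rightarrow> real"
  where "\<And>n. a n < b n" "disjoint_family (\<lambda>n. {a n<..<b n})" "S = (\<Union>n. {a n<..<b n})"
proof -
  let ?C = "components S"
  have op: "open c" if "c \<in> ?C" for c using that S(1) open_components by blast
  have int: "c = {Inf c<..<Sup c}" if "c \<in> ?C" for c
    using op[OF that] in_components_connected[OF that] in_components_nonempty[OF that]
      bounded_subset[OF S(2) in_components_subset[OF that]]
    by (intro open_connected_real_interval)
  have "countable ?C"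
    using pairwise_disjoint_components op
    by (intro countable_disjoint_open_subsets) (auto simp: pairwise_def disjnt_def)
  moreover have "infinite ?C"
  proof
    assume fin: "finite ?C"
    have "frontier S \<subseteq> (\<Union>c\<in>?C. frontier c)"
      using frontier_Union_subset[OF fin] by (simp add: Union_components)
    moreover have "finite (frontier c)" if "c \<in> ?C" for c
    proof -
      have "closure {Inf c<..<Sup c} \<subseteq> {Inf c..Sup c}"
        by (intro closure_minimal) auto
      then have "frontier {Inf c<..<Sup c} \<subseteq> {Inf c, Sup c}"
        by (force simp: frontier_def)
      then show ?thesis using int[OF that] finite_subset by fastforce
    qed
    ultimately show False using inf fin finite_subset by blast
  qed
  ultimately have bij: "bij_betw (from_nat_into ?C) UNIV ?C"
    by (rule bij_betw_from_nat_into)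
  define I where "I = from_nat_into ?C"
  have I: "I n \<in> ?C" for n using bij by (auto simp: I_def bij_betw_def)
  have int_I: "{Inf (I n)<..<Sup (I n)} = I n" for n using int[OF I] by simp
  show ?thesis
  proof (rule that)
    show "Inf (I n) < Sup (I n)" for n
      using int_I[of n] in_components_nonempty[OF I[of n]] by fastforce
    have "I m \<noteq> I n" if "m \<noteq> n" for m n
      using bij that unfolding I_def bij_betw_def inj_on_def by auto
    then show "disjoint_family (\<lambda>n. {Inf (I n)<..<Sup (I n)})"
      unfolding int_I disjoint_family_on_def
      using I pairwise_disjoint_components[of S] by (auto simp: pairwise_def)
    have "S = \<Union>?C" by (simp add: Union_components)
    also have "?C = range I" using bij by (simp add: I_def bij_betw_def)
    finally show "S = (\<Union>n. {Inf (I n)<..<Sup (I n)})" unfolding int_I by simp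
  qed
qed

lemma interior_tile_intervals:
  obtains a b :: "nat \<Rightarrow> real"
  where "\<And>n. a n < b n" "disjoint_family (\<lambda>n. {a n<..<b n})" "interior tile = (\<Union>n. {a n<..<b n})"
proof (rule open_set_infinitely_many_intervals[OF open_interior])
  show "bounded (interior tile)"
    using bounded_subset[OF compact_imp_bounded[OF compact_tile] interior_subset] .
  have "frontier tile \<subseteq> frontier (interior tile)"
    using interior_tile_dense compact_imp_closed[OF compact_tile] by (auto simp: frontier_def)
  then show "infinite (frontier (interior tile))"
    using infinite_frontier_tile infinite_super by blast
qed (rule that)

section \<open>The boundary as a Cantor set\<close>

lemma cantor_ternary_eq: "cantor_ternary_set = digit_set 3 {0,2}"
  unfolding cantor_ternary_set_def digit_set_def by simp

lemma cantor_step: "d \<in> {0,2} \<Longrightarrow> x \<in> cantor_ternary_set \<Longrightarrow> (x + real d) / 3 \<in> cantor_ternary_set"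
  unfolding cantor_ternary_eq by (rule digit_set_step) auto

lemma cantor_cases:
  assumes "x \<in> cantor_ternary_set"
  obtains y where "y \<in> cantor_ternary_set" "x = y / 3"
    | y where "y \<in> cantor_ternary_set" "x = (y + 2) / 3"
proof -
  obtain d y where "d \<in> {0,2}" "y \<in> cantor_ternary_set" "x = (y + real d) / 3"
    using digit_set_cases[of 3 "{0,2}" x] assms unfolding cantor_ternary_eq by auto
  then show ?thesis using that by auto
qed

lemma cantor_bounds: "x \<in> cantor_ternary_set \<Longrightarrow> 0 \<le> x \<and> x \<le> 1"
  using digit_set_bounds(1)[of 3 "{0,2}" 2 x] digit_set_bounds(2)[of 3 "{0,2}" 2 x]
  unfolding cantor_ternary_eq by force

text \<open>The words \<open>0\<close>, \<open>20\<close>, \<open>22\<close> form a complete prefix code: every ternary expansion with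
  digits 0 and 2 splits uniquely into these words. Accordingly the Cantor set is also the
  attractor of three maps, with letter \<open>i\<close> standing for the \<open>i\<close>-th word, and so it has the
  same code space as the boundary pieces of the tile. The following are the ratio and the
  translation part of the map that prepends a word.\<close>
definition prefix_ratio :: "nat \<Rightarrow> real" where
  "prefix_ratio i = (if i = 0 then 1/3 else 1/9)"

definition prefix_shift :: "nat \<Rightarrow> real" where
  "prefix_shift i = (if i = 0 then 0 else if i = 1 then 2/3 else 8/9)"

interpretation prefix: affine_ifs "{0,1,2}" prefix_ratio prefix_shift
  by unfold_locales (auto simp: prefix_ratio_def)

interpretation quaternary: affine_ifs "{0,1,2}" "\<lambda>_. 1/4" "\<lambda>d. real d / 4"
  by unfold_locales auto

text \<open>The same code space also parametrises the unit interval by ternary expansions.\<close>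
interpretation ternary: affine_ifs "{0,1,2}" "\<lambda>_. 1/3" "\<lambda>d. real d / 3"
  by unfold_locales auto

lemma prefix_attractor: "prefix.attractor = cantor_ternary_set"
proof (rule prefix.attractor_unique)
  have 0: "0 \<in> cantor_ternary_set"
    using repeated_digit_in_digit_set[of 3 0 "{0,2}"] by (simp add: cantor_ternary_eq)
  then show "cantor_ternary_set \<noteq> {}" by auto
  have "compact cantor_ternary_set" unfolding cantor_ternary_eq by (rule compact_digit_set) auto
  then show "closed cantor_ternary_set" "bounded cantor_ternary_set"
    by (auto dest: compact_imp_closed compact_imp_bounded)
  show "cantor_ternary_set =
      (\<Union>i\<in>{0,1,2}. (\<lambda>x. prefix_shift i + prefix_ratio i * x) ` cantor_ternary_set)" (is "_ = ?U")
  proof (intro equalityI subsetI)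
    fix x assume "x \<in> cantor_ternary_set"
    then show "x \<in> ?U"
    proof (cases rule: cantor_cases)
      case (1 y)
      then show ?thesis by (auto simp: prefix_shift_def prefix_ratio_def)
    next
      case (2 y)
      from 2(1) show ?thesis
      proof (cases rule: cantor_cases)
        case (1 z)
        then have "x = prefix_shift 1 + prefix_ratio 1 * z"
          using 2 by (simp add: prefix_shift_def prefix_ratio_def field_simps)
        then show ?thesis using 1 by blast
      next
        case (2 z)
        then have "x = prefix_shift 2 + prefix_ratio 2 * z"
          using \<open>x = (y + 2) / 3\<close> by (simp add: prefix_shift_def prefix_ratio_def field_simps)
        then show ?thesis using 2 by blast
      qed
    qed
  next
    fix x assume "x \<in> ?U"
    then obtain i y where i: "i \<in> {0,1,2}" and y: "y \<in> cantor_ternary_set"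
      and x: "x = prefix_shift i + prefix_ratio i * y" by blast
    consider "x = (y + real 0) / 3" | "x = ((y + real 0) / 3 + real 2) / 3"
      | "x = ((y + real 2) / 3 + real 2) / 3"
      using i x by (auto simp: prefix_shift_def prefix_ratio_def field_simps)
    then show "x \<in> cantor_ternary_set"
      by cases (simp_all only: cantor_step y insert_iff simp_thms)
  qed
qed

lemma prefix_inj: "inj_on prefix.code_sum prefix.codes"
proof (rule prefix.inj_on_code_sum)
  fix i j x y assume "i \<in> {0,1,2::nat}" "j \<in> {0,1,2::nat}"
    and "x \<in> prefix.attractor" "y \<in> prefix.attractor"
    and "prefix_shift i + prefix_ratio i * x = prefix_shift j + prefix_ratio j * y"
  then show "i = j"
    using cantor_bounds[of x] cantor_bounds[of y] unfolding prefix_attractor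
    by (auto simp: prefix_shift_def prefix_ratio_def)
qed

lemma quaternary_attractor: "quaternary.attractor = edge"
  unfolding edge_def by (subst digit_set_eq_attractor) auto

lemma ternary_attractor: "ternary.attractor = {0..1}"
  unfolding unit_interval_eq_digit_set[symmetric] by (subst digit_set_eq_attractor) auto

lemma quaternary_inj: "inj_on quaternary.code_sum quaternary.codes"
proof (rule quaternary.inj_on_code_sum)
  fix i j :: nat and x y :: real assume "i \<in> {0,1,2}" "j \<in> {0,1,2}"
    and "x \<in> quaternary.attractor" "y \<in> quaternary.attractor" "real i / 4 + 1/4 * x = real j / 4 + 1/4 * y"
  then show "i = j"
    using edge_bounds[of x] edge_bounds[of y] unfolding quaternary_attractor by auto
qed

text \<open>Both the boundary and the Cantor set consist of two disjoint copies of an attractor with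
  code space \<open>{0,1,2}\<close>-sequences: the former is \<open>edge\<close> and \<open>edge + 1\<close>, the latter is its left
  and its right third. Both are thus continuous injective images of one compact space.\<close>
lemma is_cantor_set_frontier_tile: "is_cantor_set (frontier tile)"
proof -
  define S where "S = {0, 1::nat} \<times> quaternary.codes"
  have cS: "compact S" unfolding S_def by (intro compact_Times quaternary.compact_codes finite_imp_compact) auto
  have inE: "quaternary.code_sum \<omega> \<in> edge" if "\<omega> \<in> quaternary.codes" for \<omega>
    using that unfolding quaternary_attractor[symmetric] quaternary.attractor_def by simp
  have inC: "prefix.code_sum \<omega> \<in> cantor_ternary_set" if "\<omega> \<in> quaternary.codes" for \<omega>
    using that unfolding prefix_attractor[symmetric] prefix.attractor_def by simp
  have fst: "continuous_on S (\<lambda>p. real (fst p))"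
    by (rule continuous_on_compose2[of UNIV real]) (auto intro: continuous_intros)
  define f where "f p = real (fst p) + quaternary.code_sum (snd p)" for p
  define g where "g p = (2 * real (fst p) + prefix.code_sum (snd p)) / 3" for p
  have "S homeomorphic frontier tile"
  proof (rule homeomorphic_compact[OF cS])
    show "continuous_on S f" unfolding f_def
      by (intro continuous_intros fst continuous_on_compose2[OF quaternary.continuous_on_code_sum])
         (auto simp: S_def)
    show "inj_on f S"
    proof (rule inj_onI)
      fix p q assume pq: "p \<in> S" "q \<in> S" "f p = f q"
      then have m: "snd p \<in> quaternary.codes" "snd q \<in> quaternary.codes" by (auto simp: S_def)
      have "fst p = fst q"
        using pq edge_bounds[OF inE[OF m(1)]] edge_bounds[OF inE[OF m(2)]] by (auto simp: S_def f_def)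
      then show "p = q" using pq(3) inj_onD[OF quaternary_inj _ m] by (auto simp: f_def prod_eq_iff)
    qed
    have "f ` S = (\<Union>j\<in>{0,1::nat}. (\<lambda>x. real j + x) ` edge)"
      unfolding quaternary_attractor[symmetric] quaternary.attractor_def S_def f_def by force
    also have "\<dots> = frontier tile" unfolding frontier_tile by (auto simp: add.commute)
    finally show "f ` S = frontier tile" .
  qed
  moreover have "S homeomorphic cantor_ternary_set"
  proof (rule homeomorphic_compact[OF cS])
    show "continuous_on S g" unfolding g_def
      by (intro continuous_intros fst continuous_on_compose2[OF prefix.continuous_on_code_sum])
         (auto simp: S_def)
    show "inj_on g S"
    proof (rule inj_onI)
      fix p q assume pq: "p \<in> S" "q \<in> S" "g p = g q"
      then have m: "snd p \<in> quaternary.codes" "snd q \<in> quaternary.codes" by (auto simp: S_def)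
      have "fst p = fst q"
        using pq cantor_bounds[OF inC[OF m(1)]] cantor_bounds[OF inC[OF m(2)]] by (auto simp: S_def g_def)
      then show "p = q" using pq(3) inj_onD[OF prefix_inj _ m] by (auto simp: g_def prod_eq_iff)
    qed
    show "g ` S = cantor_ternary_set"
    proof (intro equalityI subsetI)
      fix x assume "x \<in> g ` S"
      then obtain p where p: "p \<in> S" "x = g p" by auto
      then have "prefix.code_sum (snd p) \<in> cantor_ternary_set" using inC by (auto simp: S_def)
      moreover have "x = (prefix.code_sum (snd p) + real (2 * fst p)) / 3"
        using p by (simp add: g_def)
      moreover have "2 * fst p \<in> {0,2}" using p(1) by (auto simp: S_def)
      ultimately show "x \<in> cantor_ternary_set" by (simp only: cantor_step)
    next
      fix x assume "x \<in> cantor_ternary_set"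
      then obtain j y where jy: "j \<in> {0,1::nat}" "y \<in> cantor_ternary_set" "x = (2 * real j + y) / 3"
      proof (cases rule: cantor_cases)
        case (1 y)
        then show ?thesis by (intro that[of 0 y]) auto
      next
        case (2 y)
        then show ?thesis by (intro that[of 1 y]) auto
      qed
      then obtain \<omega> where "\<omega> \<in> quaternary.codes" "y = prefix.code_sum \<omega>"
        unfolding prefix_attractor[symmetric] prefix.attractor_def by blast
      then show "x \<in> g ` S" using jy
        by (intro image_eqI[of _ _ "(j, \<omega>)"]) (auto simp: g_def S_def)
    qed
  qed
  ultimately show ?thesis
    unfolding is_cantor_set_def using homeomorphic_sym homeomorphic_trans by blast
qed

section \<open>Hausdorff dimension\<close>

lemma hausdorff_premeasure_le_finite:
  fixes V :: "'b \<Rightarrow> 'a::metric_space set"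
  assumes P: "finite P" and cov: "A \<subseteq> (\<Union>c\<in>P. V c)" and \<delta>: "0 \<le> \<delta>"
    and V: "\<And>c. c \<in> P \<Longrightarrow> bounded (V c) \<and> diameter (V c) \<le> \<delta>"
  shows "hausdorff_premeasure s \<delta> A \<le> (\<Sum>c\<in>P. diam_pow s (V c))"
proof -
  obtain h where h: "bij_betw h {..<card P} P"
    using ex_bij_betw_nat_finite[OF P] by (auto simp: atLeast0LessThan)
  define U where "U i = (if i < card P then V (h i) else {})" for i
  have hP: "h i \<in> P" if "i < card P" for i using h that by (auto simp: bij_betw_def)
  have "A \<subseteq> (\<Union>i. U i)"
  proof
    fix x assume "x \<in> A"
    then obtain c where c: "c \<in> P" "x \<in> V c" using cov by blast
    obtain i where "i < card P" "c = h i" using h c(1) by (auto simp: bij_betw_def)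
    then show "x \<in> (\<Union>i. U i)" using c(2) by (auto simp: U_def intro!: exI[of _ i])
  qed
  moreover have "\<forall>i. bounded (U i) \<and> diameter (U i) \<le> \<delta>"
    using V hP \<delta> by (auto simp: U_def)
  ultimately have "hausdorff_premeasure s \<delta> A \<le> (\<Sum>i. diam_pow s (U i))"
    unfolding hausdorff_premeasure_def by (intro Inf_lower) blast
  also have "\<dots> = (\<Sum>i<card P. diam_pow s (U i))"
    by (intro suminf_finite) (auto simp: U_def diam_pow_def)
  also have "\<dots> = (\<Sum>i<card P. diam_pow s (V (h i)))"
    by (intro sum.cong) (auto simp: U_def)
  also have "\<dots> = (\<Sum>c\<in>P. diam_pow s (V c))"
    by (rule sum.reindex_bij_betw[OF h])
  finally show ?thesis .
qed

text \<open>If \<open>K * N ^ n\<close> intervals of length \<open>(1 / q) ^ n\<close> cover \<open>A\<close> for each \<open>n\<close>, the measure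
  vanishes for every exponent above \<open>log q N\<close>: the sums are at most \<open>K * (N / q powr s) ^ n\<close>.\<close>
lemma hausdorff_measure_eq_0_of_covers:
  fixes A :: "real set"
  assumes s: "0 < s" and q: "1 < q" "N < q powr s" "0 \<le> N"
    and cov: "\<And>n. \<exists>P. finite P \<and> real (card P) \<le> K * N ^ n \<and> A \<subseteq> (\<Union>c\<in>P. {c..c + (1 / q) ^ n})"
  shows "hausdorff_measure s A = 0"
proof -
  have "hausdorff_premeasure s \<delta> A \<le> ennreal \<epsilon>" if \<delta>: "0 < \<delta>" and \<epsilon>: "0 < \<epsilon>" for \<delta> \<epsilon>
  proof -
    have "(\<lambda>n. (1 / q) ^ n) \<longlonglongrightarrow> 0" using q by (intro LIMSEQ_power_zero) auto
    then have 1: "\<forall>\<^sub>F n in sequentially. (1 / q) ^ n < \<delta>" using \<delta> by (rule order_tendstoD)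
    have "(\<lambda>n. K * (N / q powr s) ^ n) \<longlonglongrightarrow> 0"
      using q by (intro tendsto_mult_right_zero LIMSEQ_power_zero) auto
    then have "\<forall>\<^sub>F n in sequentially. K * (N / q powr s) ^ n < \<epsilon>" using \<epsilon> by (rule order_tendstoD)
    then have "\<forall>\<^sub>F n in sequentially. (1 / q) ^ n < \<delta> \<and> K * (N / q powr s) ^ n < \<epsilon>"
      using 1 by eventually_elim simp
    then obtain n where n: "(1 / q) ^ n < \<delta>" "K * (N / q powr s) ^ n < \<epsilon>"
      using eventually_happens'[OF sequentially_bot] by blast
    let ?L = "(1 / q) ^ n"
    have L: "0 < ?L" using q by simp
    obtain P where P: "finite P" "real (card P) \<le> K * N ^ n" "A \<subseteq> (\<Union>c\<in>P. {c..c + ?L})"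
      using cov by blast
    have Ls: "?L powr s = (1 / q powr s) ^ n"
      using q by (simp add: powr_powr powr_divide powr_power power_one_over mult.commute flip: powr_realpow)
    have "hausdorff_premeasure s \<delta> A \<le> (\<Sum>c\<in>P. diam_pow s {c..c + ?L})"
      using n(1) L \<delta> by (intro hausdorff_premeasure_le_finite[OF P(1,3)]) auto
    also have "\<dots> = (\<Sum>c\<in>P. ennreal (?L powr s))"
      using s q by (intro sum.cong) (auto simp: diam_pow_def)
    also have "\<dots> = ennreal (real (card P) * ?L powr s)"
      by (simp add: ennreal_mult ennreal_of_nat_eq_real_of_nat)
    also have "\<dots> \<le> ennreal (K * N ^ n * ?L powr s)"
      using P(2) by (intro ennreal_leI mult_right_mono) auto
    also have "K * N ^ n * ?L powr s = K * (N / q powr s) ^ n"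
      unfolding Ls by (simp add: power_divide)
    also have "ennreal \<dots> \<le> ennreal \<epsilon>" using n(2) by (intro ennreal_leI) simp
    finally show ?thesis .
  qed
  then have "hausdorff_premeasure s \<delta> A = 0" if "0 < \<delta>" for \<delta>
    using that by (metis ennreal_le_epsilon add_0 zero_le bot.extremum_unique bot_ennreal)
  then show ?thesis unfolding hausdorff_measure_def by (simp add: SUP_constant)
qed

text \<open>A Hoelder map of exponent \<open>t\<close> sends a covering set \<open>U\<close> into an interval of length
  \<open>2 * c * diameter U powr t\<close>. If it maps onto the unit interval, these lengths add up to at
  least 1. Restricting to covers by sets of diameter at most 1 allows any exponent below \<open>t\<close>.\<close>
lemma hausdorff_measure_ne_0_of_hoelder:
  fixes A :: "real set" and f :: "real \<Rightarrow> real"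
  assumes st: "0 \<le> s" "s \<le> t" "0 < t" and c: "0 < c"
    and hoelder: "\<And>x y. x \<in> A \<Longrightarrow> y \<in> A \<Longrightarrow> \<bar>f x - f y\<bar> \<le> c * \<bar>x - y\<bar> powr t"
    and onto: "{0..1} \<subseteq> f ` A"
  shows "hausdorff_measure s A \<noteq> 0"
proof -
  have "ennreal (1 / (2 * c)) \<le> hausdorff_premeasure s 1 A"
    unfolding hausdorff_premeasure_def
  proof (rule Inf_greatest, clarify)
    fix U :: "nat \<Rightarrow> real set"
    assume cov: "A \<subseteq> (\<Union>i. U i)" and U: "\<forall>i. bounded (U i) \<and> diameter (U i) \<le> 1"
    have "\<exists>J. f ` (U i \<inter> A) \<subseteq> J \<and> J \<in> sets lborel \<and> emeasure lborel J \<le> ennreal (2 * c) * diam_pow s (U i)" for i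
    proof (cases "U i \<inter> A = {}")
      case True
      then show ?thesis by (intro exI[of _ "{}"]) simp
    next
      case False
      then obtain x where x: "x \<in> U i" "x \<in> A" by auto
      define w where "w = c * diameter (U i) powr t"
      have "f ` (U i \<inter> A) \<subseteq> {f x - w..f x + w}"
      proof clarify
        fix y assume y: "y \<in> U i" "y \<in> A"
        have "\<bar>y - x\<bar> \<le> diameter (U i)"
          using diameter_bounded_bound[of "U i" y x] U x y by (simp add: dist_real_def)
        then have "c * \<bar>y - x\<bar> powr t \<le> w"
          unfolding w_def using c st by (intro mult_left_mono powr_mono2) auto
        then show "f y \<in> {f x - w..f x + w}"
          using hoelder[OF y(2) x(2)] by (auto simp: abs_le_iff)
      qed
      moreover have "emeasure lborel {f x - w..f x + w} \<le> ennreal (2 * c) * diam_pow s (U i)"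
      proof -
        have d: "0 \<le> diameter (U i)" "diameter (U i) \<le> 1" using U diameter_ge_0 by auto
        have w0: "0 \<le> w" using c by (simp add: w_def)
        have "emeasure lborel {f x - w..f x + w} = ennreal (2 * c) * ennreal (diameter (U i) powr t)"
          using w0 c by (simp add: w_def ennreal_mult[symmetric] mult.assoc)
        also have "ennreal (diameter (U i) powr t) \<le> diam_pow s (U i)"
        proof (cases "s = 0")
          case True
          have "diameter (U i) powr t \<le> 1" using d st by (intro powr_le1) auto
          then have "ennreal (diameter (U i) powr t) \<le> 1" by simp
          then show ?thesis using x True unfolding diam_pow_def by auto
        next
          case False
          then have "diameter (U i) powr t \<le> diameter (U i) powr s"
            using d st by (intro powr_mono') auto
          then show ?thesis using x False by (auto simp: diam_pow_def intro: ennreal_leI)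
        qed
        finally show ?thesis by (simp add: mult_left_mono)
      qed
      ultimately show ?thesis by (intro exI[of _ "{f x - w..f x + w}"]) simp
    qed
    then obtain J where J: "\<And>i. f ` (U i \<inter> A) \<subseteq> J i" "\<And>i. J i \<in> sets lborel"
        "\<And>i. emeasure lborel (J i) \<le> ennreal (2 * c) * diam_pow s (U i)" by metis
    have "{0..1} \<subseteq> (\<Union>i. J i)"
    proof
      fix z :: real assume "z \<in> {0..1}"
      then obtain x where x: "x \<in> A" "z = f x" using onto by auto
      then obtain i where "x \<in> U i" using cov by auto
      then show "z \<in> (\<Union>i. J i)" using J(1)[of i] x by auto
    qed
    then have "emeasure lborel {0..1::real} \<le> emeasure lborel (\<Union>i. J i)"
      using J(2) by (intro emeasure_mono) auto
    also have "\<dots> \<le> (\<Sum>i. emeasure lborel (J i))"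
      using J(2) by (intro emeasure_subadditive_countably) auto
    also have "\<dots> \<le> (\<Sum>i. ennreal (2 * c) * diam_pow s (U i))"
      using J(3) by (intro suminf_le) auto
    also have "\<dots> = ennreal (2 * c) * (\<Sum>i. diam_pow s (U i))" by simp
    finally have "1 \<le> ennreal (2 * c) * (\<Sum>i. diam_pow s (U i))" by simp
    then have "ennreal (1 / (2 * c)) * 1 \<le> ennreal (1 / (2 * c)) * (ennreal (2 * c) * (\<Sum>i. diam_pow s (U i)))"
      by (rule mult_left_mono) simp
    also have "\<dots> = (\<Sum>i. diam_pow s (U i))"
      using c by (simp add: mult.assoc[symmetric] ennreal_mult[symmetric])
    finally show "ennreal (1 / (2 * c)) \<le> (\<Sum>i. diam_pow s (U i))" by simp
  qed
  also have "\<dots> \<le> hausdorff_measure s A"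
    unfolding hausdorff_measure_def by (intro SUP_upper) auto
  finally show ?thesis using c by (auto simp: ennreal_eq_0_iff)
qed

lemma hausdorff_dim_eqI:
  assumes t: "0 \<le> t" and up: "\<And>s. t < s \<Longrightarrow> hausdorff_measure s A = 0"
    and low: "\<And>s. 0 \<le> s \<Longrightarrow> s \<le> t \<Longrightarrow> hausdorff_measure s A \<noteq> 0"
  shows "hausdorff_dim A = ereal t"
  unfolding hausdorff_dim_def
proof (rule antisym)
  show "Inf {ereal s |s. 0 \<le> s \<and> hausdorff_measure s A = 0} \<le> ereal t"
  proof (rule ereal_le_epsilon2)
    fix e :: real assume "0 < e"
    then have "ereal (t + e) \<in> {ereal s |s. 0 \<le> s \<and> hausdorff_measure s A = 0}"
      using t up[of "t + e"] by auto
    then show "Inf {ereal s |s. 0 \<le> s \<and> hausdorff_measure s A = 0} \<le> ereal t + ereal e"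
      by (simp add: Inf_lower)
  qed
  show "ereal t \<le> Inf {ereal s |s. 0 \<le> s \<and> hausdorff_measure s A = 0}"
  proof (rule Inf_greatest, clarify)
    fix s assume "0 \<le> s" "hausdorff_measure s A = 0"
    then show "ereal t \<le> ereal s" using low[of s] by force
  qed
qed

lemma edge_cover: "\<exists>P. finite P \<and> card P \<le> 3 ^ n \<and> edge \<subseteq> (\<Union>c\<in>P. {c..c + (1/4) ^ n})"
proof (induction n)
  case 0
  then show ?case using edge_bounds by (intro exI[of _ "{0}"]) force
next
  case (Suc n)
  then obtain P where P: "finite P" "card P \<le> 3 ^ n" "edge \<subseteq> (\<Union>c\<in>P. {c..c + (1/4) ^ n})" by blast
  let ?Q = "(\<lambda>(d, c). (c + real d) / 4) ` ({0,1,2} \<times> P)"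
  have "card ?Q \<le> card ({0,1,2::nat} \<times> P)" using P(1) by (intro card_image_le) simp
  also have "\<dots> \<le> 3 ^ Suc n" using P(2) by (simp add: card_cartesian_product)
  finally have "card ?Q \<le> 3 ^ Suc n" .
  moreover have "edge \<subseteq> (\<Union>c\<in>?Q. {c..c + (1/4) ^ Suc n})"
  proof
    fix x assume "x \<in> edge"
    then obtain d y where d: "d \<in> {0,1,2}" "y \<in> edge" "x = (y + real d) / 4"
      using digit_set_cases[of 4 "{0,1,2}" x] unfolding edge_def by auto
    obtain c where c: "c \<in> P" "y \<in> {c..c + (1/4) ^ n}" using P(3) d(2) by blast
    then have "x \<in> {(c + real d) / 4..(c + real d) / 4 + (1/4) ^ Suc n}"
      using d(3) by (simp add: add_divide_distrib)
    moreover have "(c + real d) / 4 \<in> ?Q" using c(1) d(1) by (intro image_eqI[of _ _ "(d, c)"]) auto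
    ultimately show "x \<in> (\<Union>c\<in>?Q. {c..c + (1/4) ^ Suc n})" by blast
  qed
  ultimately show ?case using P(1) by (intro exI[of _ ?Q]) simp
qed

lemma frontier_tile_cover:
  "\<exists>P. finite P \<and> real (card P) \<le> 2 * 3 ^ n \<and> frontier tile \<subseteq> (\<Union>c\<in>P. {c..c + (1/4) ^ n})"
proof -
  obtain P where P: "finite P" "card P \<le> 3 ^ n" "edge \<subseteq> (\<Union>c\<in>P. {c..c + (1/4) ^ n})"
    using edge_cover by blast
  let ?Q = "P \<union> (\<lambda>c. c + 1) ` P"
  have "card ?Q \<le> card P + card ((\<lambda>c. c + 1) ` P)" by (rule card_Un_le)
  also have "\<dots> \<le> 2 * 3 ^ n" using P(2) card_image_le[OF P(1), of "\<lambda>c. c + 1"] by simp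
  finally have "real (card ?Q) \<le> real (2 * 3 ^ n)" by (simp only: of_nat_le_iff)
  moreover have "frontier tile \<subseteq> (\<Union>c\<in>?Q. {c..c + (1/4) ^ n})"
    unfolding frontier_tile using P(3) by (fastforce simp: algebra_simps)
  ultimately show ?thesis using P(1) by (intro exI[of _ ?Q]) simp
qed

text \<open>Reading the digits of a base 4 expansion in base 3 maps \<open>edge\<close> onto the unit interval.
  If two codes first differ at position \<open>n\<close>, the base 4 values differ by at least \<open>4 ^ -n / 12\<close>,
  because two neighbouring pieces of \<open>edge\<close> are at distance \<open>(1 - 2/3) / 4\<close>, while the
  base 3 values differ by at most \<open>3 ^ -n\<close>.\<close>
lemma edge_code_separation:
  assumes "\<omega> \<in> quaternary.codes" "\<eta> \<in> quaternary.codes" "\<And>k. k < n \<Longrightarrow> \<omega> k = \<eta> k" "\<omega> n \<noteq> \<eta> n"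
  shows "(1/4) ^ n / 12 \<le> \<bar>quaternary.code_sum \<omega> - quaternary.code_sum \<eta>\<bar> \<and>
    \<bar>ternary.code_sum \<omega> - ternary.code_sum \<eta>\<bar> \<le> (1/3) ^ n"
  using assms
proof (induction n arbitrary: \<omega> \<eta>)
  case 0
  let ?u = "quaternary.code_sum (\<lambda>n. \<omega> (Suc n))" and ?v = "quaternary.code_sum (\<lambda>n. \<eta> (Suc n))"
  have sh: "(\<lambda>n. \<omega> (Suc n)) \<in> quaternary.codes" "(\<lambda>n. \<eta> (Suc n)) \<in> quaternary.codes"
    by (rule quaternary.codes_shift[OF 0(1)], rule quaternary.codes_shift[OF 0(2)])
  have b: "?u \<in> edge" "?v \<in> edge"
    using sh unfolding quaternary_attractor[symmetric] quaternary.attractor_def by auto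
  have t: "ternary.code_sum \<omega> \<in> {0..1}" "ternary.code_sum \<eta> \<in> {0..1}"
    using 0 unfolding ternary_attractor[symmetric] ternary.attractor_def by auto
  have gap: "1 / 12 \<le> \<bar>c\<bar>" if "1 \<le> \<bar>a\<bar>" "\<bar>b\<bar> \<le> 2/3" "c = (a + b) / 4" for a b c :: real
    using that by (auto simp: abs_if split: if_splits)
  have "1 \<le> \<bar>real (\<omega> 0) - real (\<eta> 0)\<bar>" using 0(4) by linarith
  moreover have "\<bar>?u - ?v\<bar> \<le> 2/3" using edge_bounds[OF b(1)] edge_bounds[OF b(2)] by linarith
  moreover have "quaternary.code_sum \<omega> - quaternary.code_sum \<eta> = ((real (\<omega> 0) - real (\<eta> 0)) + (?u - ?v)) / 4"
    unfolding quaternary.code_sum_unfold[OF 0(1)] quaternary.code_sum_unfold[OF 0(2)] by (simp add: field_simps)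
  ultimately have "1 / 12 \<le> \<bar>quaternary.code_sum \<omega> - quaternary.code_sum \<eta>\<bar>" by (rule gap)
  moreover have "\<bar>ternary.code_sum \<omega> - ternary.code_sum \<eta>\<bar> \<le> 1" using t by auto
  ultimately show ?case by simp
next
  case (Suc n)
  have sh: "(\<lambda>n. \<omega> (Suc n)) \<in> quaternary.codes" "(\<lambda>n. \<eta> (Suc n)) \<in> quaternary.codes"
    by (rule quaternary.codes_shift[OF Suc.prems(1)], rule quaternary.codes_shift[OF Suc.prems(2)])
  have "\<omega> 0 = \<eta> 0" using Suc.prems(3) by simp
  then have "quaternary.code_sum \<omega> - quaternary.code_sum \<eta> =
        (quaternary.code_sum (\<lambda>n. \<omega> (Suc n)) - quaternary.code_sum (\<lambda>n. \<eta> (Suc n))) / 4"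
      "ternary.code_sum \<omega> - ternary.code_sum \<eta> =
        (ternary.code_sum (\<lambda>n. \<omega> (Suc n)) - ternary.code_sum (\<lambda>n. \<eta> (Suc n))) / 3"
    unfolding quaternary.code_sum_unfold[OF Suc.prems(1)] quaternary.code_sum_unfold[OF Suc.prems(2)]
      ternary.code_sum_unfold[OF Suc.prems(1)] ternary.code_sum_unfold[OF Suc.prems(2)]
    by (simp_all add: field_simps)
  moreover have "(1/4) ^ n / 12 \<le> \<bar>quaternary.code_sum (\<lambda>n. \<omega> (Suc n)) - quaternary.code_sum (\<lambda>n. \<eta> (Suc n))\<bar> \<and>
    \<bar>ternary.code_sum (\<lambda>n. \<omega> (Suc n)) - ternary.code_sum (\<lambda>n. \<eta> (Suc n))\<bar> \<le> (1/3) ^ n"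
    using Suc.prems by (intro Suc.IH[OF sh]) auto
  ultimately show ?case by (simp only: abs_divide abs_numeral power_Suc) simp
qed

lemma edge_digit_map_hoelder:
  assumes "\<omega> \<in> quaternary.codes" "\<eta> \<in> quaternary.codes"
  shows "\<bar>ternary.code_sum \<omega> - ternary.code_sum \<eta>\<bar>
    \<le> 12 powr log 4 3 * \<bar>quaternary.code_sum \<omega> - quaternary.code_sum \<eta>\<bar> powr log 4 3"
proof (cases "\<omega> = \<eta>")
  case False
  then have "\<exists>n. \<omega> n \<noteq> \<eta> n" by auto
  define n where "n = (LEAST n. \<omega> n \<noteq> \<eta> n)"
  have "\<omega> n \<noteq> \<eta> n" unfolding n_def by (rule LeastI_ex) fact
  moreover have "\<omega> k = \<eta> k" if "k < n" for k using not_less_Least that unfolding n_def by blast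
  ultimately have sep: "(1/4) ^ n \<le> 12 * \<bar>quaternary.code_sum \<omega> - quaternary.code_sum \<eta>\<bar>"
      "\<bar>ternary.code_sum \<omega> - ternary.code_sum \<eta>\<bar> \<le> (1/3) ^ n"
    using edge_code_separation[OF assms, of n] by auto
  have l: "0 < log 4 (3::real)" by simp
  \<comment> \<open>The exponent is the one that turns powers of 4 into powers of 3.\<close>
  have "(1/3::real) ^ n = ((1/4) ^ n) powr log 4 3"
  proof -
    have "((4::real) ^ n) powr log 4 3 = (4 powr real n) powr log 4 3"
      by (simp add: powr_realpow)
    also have "\<dots> = (4 powr log 4 3) powr real n" by (simp only: powr_powr mult.commute)
    also have "\<dots> = 3 ^ n" by (simp add: powr_realpow)
    finally show ?thesis by (simp add: power_one_over powr_divide)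
  qed
  also have "\<dots> \<le> (12 * \<bar>quaternary.code_sum \<omega> - quaternary.code_sum \<eta>\<bar>) powr log 4 3"
    using sep(1) l by (intro powr_mono2) auto
  also have "\<dots> = 12 powr log 4 3 * \<bar>quaternary.code_sum \<omega> - quaternary.code_sum \<eta>\<bar> powr log 4 3"
    by (simp add: powr_mult)
  finally show ?thesis using sep(2) by simp
qed simp

lemma hausdorff_dim_frontier_tile: "hausdorff_dim (frontier tile) = ereal (log 4 3)"
proof (rule hausdorff_dim_eqI)
  show "0 \<le> log 4 (3::real)" by simp
  show "hausdorff_measure s (frontier tile) = 0" if s: "log 4 3 < s" for s
  proof (rule hausdorff_measure_eq_0_of_covers)
    have "0 < log 4 (3::real)" by simp
    then show "0 < s" using s by linarith
    have "4 powr log 4 3 < (4::real) powr s" using s by (intro powr_less_mono) auto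
    then show "(3::real) < 4 powr s" by simp
    show "\<exists>P. finite P \<and> real (card P) \<le> 2 * 3 ^ n \<and> frontier tile \<subseteq> (\<Union>c\<in>P. {c..c + (1 / 4) ^ n})" for n
      by (rule frontier_tile_cover)
  qed auto
  define f where "f x = ternary.code_sum (inv_into quaternary.codes quaternary.code_sum x)" for x
  have f: "f (quaternary.code_sum \<omega>) = ternary.code_sum \<omega>" if "\<omega> \<in> quaternary.codes" for \<omega>
    using that quaternary_inj by (simp add: f_def)
  show "hausdorff_measure s (frontier tile) \<noteq> 0" if s: "0 \<le> s" "s \<le> log 4 3" for s
  proof
    assume "hausdorff_measure s (frontier tile) = 0"
    moreover have "hausdorff_measure s edge \<le> hausdorff_measure s (frontier tile)"
      unfolding hausdorff_measure_def hausdorff_premeasure_def frontier_tile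
      by (intro SUP_mono' Inf_superset_mono) blast
    moreover have "hausdorff_measure s edge \<noteq> 0"
    proof (rule hausdorff_measure_ne_0_of_hoelder[OF s])
      show "\<bar>f x - f y\<bar> \<le> 12 powr log 4 3 * \<bar>x - y\<bar> powr log 4 3" if xy: "x \<in> edge" "y \<in> edge" for x y
      proof -
        obtain \<omega> \<eta> where "\<omega> \<in> quaternary.codes" "x = quaternary.code_sum \<omega>" "\<eta> \<in> quaternary.codes" "y = quaternary.code_sum \<eta>"
          using xy unfolding quaternary_attractor[symmetric] quaternary.attractor_def by auto
        then show ?thesis using edge_digit_map_hoelder f by simp
      qed
      have "f ` edge = ternary.code_sum ` quaternary.codes"
        unfolding quaternary_attractor[symmetric] quaternary.attractor_def image_image
        by (intro image_cong refl f)
      also have "\<dots> = {0..1}" unfolding ternary_attractor[symmetric] ternary.attractor_def ..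
      finally show "{0..1} \<subseteq> f ` edge" by simp
    qed auto
    ultimately show False by simp
  qed
qed

lemma log_4_3_not_Int: "log 4 3 \<notin> \<int>"
proof
  assume "log 4 3 \<in> (\<int> :: real set)"
  then obtain k :: int where k: "log 4 (3::real) = real_of_int k" by (auto elim: Ints_cases)
  have "0 < log 4 (3::real)" "log 4 (3::real) < 1" by (simp_all add: log_less_one_cancel_iff)
  then show False unfolding k by simp
qed

section \<open>Subsums of the Guthrie--Nymann series\<close>

lemma summable_guthrie_nymann:
  assumes "\<forall>n\<ge>1. \<epsilon> n \<in> {0, 1::real}"
  shows "summable (\<lambda>n. \<epsilon> (Suc n) * guthrie_nymann (Suc n))"
proof (rule summable_comparison_test')
  show "summable (\<lambda>n. 3 * (1/2::real) ^ n)"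
    by (rule summable_mult[OF summable_geometric]) simp
  fix n :: nat
  have "(2::real) ^ n \<le> 2 ^ (2 * ((Suc n + 1) div 2))" by (intro power_increasing) auto
  then have "(2::real) ^ n \<le> 4 ^ ((Suc n + 1) div 2)" by (simp add: power_mult)
  then have "guthrie_nymann (Suc n) \<le> 3 / 2 ^ n"
    unfolding guthrie_nymann_def by (intro frac_le) auto
  moreover have "0 \<le> guthrie_nymann (Suc n)" by (simp add: guthrie_nymann_def)
  ultimately show "norm (\<epsilon> (Suc n) * guthrie_nymann (Suc n)) \<le> 3 * (1/2) ^ n"
    using assms[rule_format, of "Suc n"] by (auto simp: power_one_over)
qed

text \<open>The pair of terms with denominator \<open>4 ^ k\<close> contributes one of the digits 0, 2, 3, 5.\<close>
lemma guthrie_nymann_pairs: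
  assumes "\<forall>n\<ge>1. \<epsilon> n \<in> {0, 1::real}"
  shows "(\<Sum>n. \<epsilon> (Suc n) * guthrie_nymann (Suc n)) =
    (\<Sum>m. (3 * \<epsilon> (2 * m + 1) + 2 * \<epsilon> (2 * m + 2)) / 4 ^ Suc m)"
proof -
  have "(\<lambda>m. \<Sum>n\<in>{m * 2..<m * 2 + 2}. \<epsilon> (Suc n) * guthrie_nymann (Suc n)) sums
      (\<Sum>n. \<epsilon> (Suc n) * guthrie_nymann (Suc n))"
    by (rule sums_group[OF summable_sums[OF summable_guthrie_nymann[OF assms]]]) auto
  moreover have "(\<Sum>n\<in>{m * 2..<m * 2 + 2}. \<epsilon> (Suc n) * guthrie_nymann (Suc n)) =
      (3 * \<epsilon> (2 * m + 1) + 2 * \<epsilon> (2 * m + 2)) / 4 ^ Suc m" for m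
  proof -
    have "{m * 2..<m * 2 + 2} = {2 * m, 2 * m + 1}" by auto
    moreover have "(2 * m + 3) div 2 = Suc m" "(2 * m + 2) div 2 = Suc m" by auto
    ultimately show ?thesis by (simp add: guthrie_nymann_def add_divide_distrib)
  qed
  ultimately show ?thesis by (simp add: sums_iff)
qed

lemma subsums_guthrie_nymann: "subsums guthrie_nymann = tile"
proof (intro equalityI subsetI)
  fix x assume "x \<in> subsums guthrie_nymann"
  then obtain \<epsilon> where \<epsilon>: "\<forall>n\<ge>1. \<epsilon> n \<in> {0, 1::real}"
    and x: "x = (\<Sum>n. \<epsilon> (Suc n) * guthrie_nymann (Suc n))" unfolding subsums_def by blast
  define \<alpha> where "\<alpha> k = 3 * \<epsilon> (2 * k - 1) + 2 * \<epsilon> (2 * k)" for k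
  have "\<alpha> n \<in> real ` {0,2,3,5}" if "n \<ge> 1" for n
  proof -
    have "\<epsilon> (2 * n - 1) \<in> {0, 1}" "\<epsilon> (2 * n) \<in> {0, 1}" using \<epsilon> that by simp_all
    then show ?thesis by (auto simp: \<alpha>_def)
  qed
  moreover have "x = (\<Sum>n. \<alpha> (Suc n) / 4 ^ Suc n)"
    unfolding x guthrie_nymann_pairs[OF \<epsilon>] by (simp add: \<alpha>_def)
  ultimately show "x \<in> tile" unfolding tile_def digit_set_def by blast
next
  fix x assume "x \<in> tile"
  then obtain \<alpha> where \<alpha>: "\<And>n. n \<ge> 1 \<Longrightarrow> \<alpha> n \<in> {0,2,3,5::real}" and x: "x = (\<Sum>n. \<alpha> (Suc n) / 4 ^ Suc n)"
    unfolding tile_def digit_set_def by auto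
  define \<epsilon> :: "nat \<Rightarrow> real" where "\<epsilon> n = (if odd n then of_bool (\<alpha> ((n + 1) div 2) \<in> {3,5})
    else of_bool (\<alpha> (n div 2) \<in> {2,5}))" for n
  have \<epsilon>: "\<forall>n\<ge>1. \<epsilon> n \<in> {0,1}" by (auto simp: \<epsilon>_def)
  have "3 * \<epsilon> (2 * m + 1) + 2 * \<epsilon> (2 * m + 2) = \<alpha> (Suc m)" for m
    using \<alpha>[of "Suc m"] by (auto simp: \<epsilon>_def)
  then have "x = (\<Sum>n. \<epsilon> (Suc n) * guthrie_nymann (Suc n))"
    unfolding guthrie_nymann_pairs[OF \<epsilon>] x by simp
  then show "x \<in> subsums guthrie_nymann" using \<epsilon> unfolding subsums_def by blast
qed

theorem corollary2:
  fixes X X_I X_C :: "real set"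
  assumes "X = {\<Sum>n. \<alpha> (Suc n) / 4 ^ Suc n | \<alpha>. \<forall>n\<ge>1. \<alpha> n \<in> {0, 2, 3, 5}}"
    and "X_I = interior X"
    and "X_C = frontier X"
  shows "X = subsums guthrie_nymann
    \<and> X = X_I \<union> X_C \<and> X_I \<inter> X_C = {}
    \<and> (\<exists>a b :: nat \<Rightarrow> real. (\<forall>n. a n < b n)
          \<and> disjoint_family (\<lambda>n. {a n<..<b n})
          \<and> X_I = (\<Union>n. {a n<..<b n}))
    \<and> emeasure lebesgue X_I = 1
    \<and> is_cantor_set X_C
    \<and> X_C \<in> null_sets lebesgue
    \<and> hausdorff_dim X_C = ereal (log 4 3)
    \<and> log 4 3 \<notin> \<int>"
proof -
  have X: "X = tile" unfolding assms(1) tile_def digit_set_def by simp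
  have I: "X_I = interior tile" and C: "X_C = frontier tile" using assms(2,3) X by simp_all
  have "tile = interior tile \<union> frontier tile"
    using interior_subset compact_imp_closed[OF compact_tile] by (auto simp: frontier_def)
  moreover have "interior tile \<inter> frontier tile = {}" by (auto simp: frontier_def)
  moreover have "\<exists>a b :: nat \<Rightarrow> real. (\<forall>n. a n < b n)
          \<and> disjoint_family (\<lambda>n. {a n<..<b n}) \<and> interior tile = (\<Union>n. {a n<..<b n})"
    by (rule interior_tile_intervals) blast
  ultimately show ?thesis
    unfolding X I C
    using subsums_guthrie_nymann emeasure_interior_tile is_cantor_set_frontier_tile
      null_frontier_tile hausdorff_dim_frontier_tile log_4_3_not_Int
    by (intro conjI) simp_all
qed

end
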